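(* Let $a>0$ and let $z=\{z(t):t\in\mathbb{R}\}$ be a Lévy process with $\mathrm E[\log\{1+|z(1)|\}]<\infty$. Let $u(s)$ be a non-Gaussian Ornstein–Uhlenbeck process, defined as a stationary solution to the stochastic differential equation $$\mathrm du(t)=-a\,u(t)\,\mathrm dt+\mathrm dz(at),\qquad t\in\mathbb{R},$$ and let $V$ be a random variable having the stationary (self-decomposable) distribution of $u$. If the distribution function $F_V$ of $V$ is absolutely continuous with exponential tail $\bar F_V\in\mathscr L_\beta$, $\beta>0$, then $(u(s_1),u(s_2))$ is asymptotically independent for $s_1\ne s_2$, and the corresponding residual tail dependence coefficient is $$\eta=\frac{1}{2-e^{-a|s_2-s_1|}}.$$
   Context: For a distribution function $F$, $\bar F=1-F$. A function $g:\mathbb{R}\to\mathbb{R}_+$ with $\lim_{x\to\infty}g(x)=0$ belongs to $\mathscr L_\beta$ if $\lim_{x\to\infty}g(x-t)/g(x)=\exp(t\beta)$ for all $t\in\mathbb{R}$. A random variable $V$ is self-decomposable if for every $\alpha\in(0,1)$, $V$ equals in distribution $\alpha V+\tilde V_\alpha$ with $\tilde V_\alpha$ independent of $V$. The solution of the stochastic differential equation is represented as $$u(s)=\int_{-\infty}^s e^{-a(s-t)}\,\mathrm dz(at)=e^{-as}u(0)+\int_0^s e^{-a(s-t)}\,\mathrm dz(at),\quad s\ge0,$$ where $u(0)$ is independent of $\int_0^s e^{-a(s-t)}\,\mathrm dz(at)$. For a random vector $(X_1,X_2)$ with marginal distribution functions $F_{X_1},F_{X_2}$: the tail dependence coefficient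 is $\chi=\lim_{q\uparrow1}\Pr(F_{X_1}(X_1)>q\mid F_{X_2}(X_2)>q)$, and $X_1,X_2$ are asymptotically independent if $\chi=0$; the residual tail dependence coefficient is $\eta=\lim_{q\uparrow1}\log(1-q)/\log\Pr(F_{X_1}(X_1)>q,F_{X_2}(X_2)>q)$ (provided these limits exist). *)

theory Defs
  imports "HOL-Probability.Probability"
begin

section \<open>Tails and tail dependence\<close>

definition df :: "'a measure \<Rightarrow> ('a \<Rightarrow> real) \<Rightarrow> real \<Rightarrow> real" where
  "df M X = cdf (distr M borel X)"

definition survival_function :: "'a measure \<Rightarrow> ('a \<Rightarrow> real) \<Rightarrow> real \<Rightarrow> real" where
  "survival_function M X x = 1 - df M X x"

text \<open>
  The class of functions with exponential tail of index \<open>\<beta>\<close>.  Since \<open>x / 0 = 0\<close>, the instance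
  \<open>t = 0\<close> of the ratio condition forces \<open>g\<close> to be eventually nonzero, so the quotients below are
  genuine ones.
\<close>

definition exponential_tail :: "real \<Rightarrow> (real \<Rightarrow> real) \<Rightarrow> bool" where
  "exponential_tail \<beta> g \<longleftrightarrow>
     (\<forall>x. 0 \<le> g x) \<and> (g \<longlongrightarrow> 0) at_top \<and>
     (\<forall>t. ((\<lambda>x. g (x - t) / g x) \<longlongrightarrow> exp (t * \<beta>)) at_top)"

text \<open>
  Both coefficients are limits that need not exist; they are rendered as relations asserting that the
  limit exists and has the given value.
\<close>

definition has_tail_dependence_coefficient ::
    "'a measure \<Rightarrow> ('a \<Rightarrow> real) \<Rightarrow> ('a \<Rightarrow> real) \<Rightarrow> real \<Rightarrow> bool" where
  "has_tail_dependence_coefficient M X\<^sub>1 X\<^sub>2 c \<longleftrightarrow>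
     ((\<lambda>q. \<P>(\<omega> in M. df M X\<^sub>1 (X\<^sub>1 \<omega>) > q \<bar> df M X\<^sub>2 (X\<^sub>2 \<omega>) > q)) \<longlongrightarrow> c) (at_left 1)"

definition asymptotically_independent ::
    "'a measure \<Rightarrow> ('a \<Rightarrow> real) \<Rightarrow> ('a \<Rightarrow> real) \<Rightarrow> bool" where
  "asymptotically_independent M X\<^sub>1 X\<^sub>2 \<longleftrightarrow> has_tail_dependence_coefficient M X\<^sub>1 X\<^sub>2 0"

definition has_residual_tail_dependence_coefficient ::
    "'a measure \<Rightarrow> ('a \<Rightarrow> real) \<Rightarrow> ('a \<Rightarrow> real) \<Rightarrow> real \<Rightarrow> bool" where
  "has_residual_tail_dependence_coefficient M X\<^sub>1 X\<^sub>2 \<eta> \<longleftrightarrow>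
     ((\<lambda>q. ln (1 - q) / ln \<P>(\<omega> in M. df M X\<^sub>1 (X\<^sub>1 \<omega>) > q \<and> df M X\<^sub>2 (X\<^sub>2 \<omega>) > q))
        \<longlongrightarrow> \<eta>) (at_left 1)"

section \<open>Processes indexed by the real line\<close>

definition cadlag :: "(real \<Rightarrow> real) \<Rightarrow> bool" where
  "cadlag f \<longleftrightarrow> (\<forall>t. continuous (at_right t) f \<and> (\<exists>l. (f \<longlongrightarrow> l) (at_left t)))"

definition levy_process :: "'a measure \<Rightarrow> (real \<Rightarrow> 'a \<Rightarrow> real) \<Rightarrow> bool" where
  "levy_process M z \<longleftrightarrow>
     (\<forall>t. z t \<in> borel_measurable M) \<and>
     (AE \<omega> in M. z 0 \<omega> = 0) \<and>
     (\<forall>(n::nat) t. strict_mono_on {..n} t \<longrightarrow>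
        prob_space.indep_vars M (\<lambda>_. borel) (\<lambda>i \<omega>. z (t (Suc i)) \<omega> - z (t i) \<omega>) {..<n}) \<and>
     (\<forall>s t h. distr M borel (\<lambda>\<omega>. z (t + h) \<omega> - z (s + h) \<omega>) =
              distr M borel (\<lambda>\<omega>. z t \<omega> - z s \<omega>)) \<and>
     (\<forall>t. \<forall>\<epsilon>>0. ((\<lambda>s. \<P>(\<omega> in M. \<bar>z s \<omega> - z t \<omega>\<bar> > \<epsilon>)) \<longlongrightarrow> 0) (at t)) \<and>
     (AE \<omega> in M. cadlag (\<lambda>t. z t \<omega>))"

definition strictly_stationary :: "'a measure \<Rightarrow> (real \<Rightarrow> 'a \<Rightarrow> real) \<Rightarrow> bool" where
  "strictly_stationary M X \<longleftrightarrow>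
     (\<forall>J h. finite J \<longrightarrow>
        distr M (\<Pi>\<^sub>M t\<in>J. borel) (\<lambda>\<omega>. \<lambda>t\<in>J. X (t + h) \<omega>) =
        distr M (\<Pi>\<^sub>M t\<in>J. borel) (\<lambda>\<omega>. \<lambda>t\<in>J. X t \<omega>))"

text \<open>Constants count as (degenerate) normal random variables.\<close>

definition normal_rv :: "'a measure \<Rightarrow> ('a \<Rightarrow> real) \<Rightarrow> bool" where
  "normal_rv M Y \<longleftrightarrow>
     (\<exists>\<mu> \<sigma>. \<sigma> > 0 \<and> distributed M lborel Y (normal_density \<mu> \<sigma>)) \<or>
     (\<exists>\<mu>. AE \<omega> in M. Y \<omega> = \<mu>)"

definition gaussian_process :: "'a measure \<Rightarrow> (real \<Rightarrow> 'a \<Rightarrow> real) \<Rightarrow> bool" where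
  "gaussian_process M X \<longleftrightarrow>
     (\<forall>J c. finite J \<longrightarrow> normal_rv M (\<lambda>\<omega>. \<Sum>t\<in>J. c t * X t \<omega>))"

text \<open>
  Since the noise in \<open>du(t) = - a u(t) dt + dz(at)\<close> is additive, the equation is understood pathwise
  in its integrated form \<open>u(t) - u(s) = - a \<integral>\<^sub>s\<^sup>t u(r) dr + z(at) - z(as)\<close>.  No independence of \<open>u(0)\<close>
  and the increments of \<open>z\<close> after time \<open>0\<close> is required.
\<close>

definition OU_equation ::
    "'a measure \<Rightarrow> real \<Rightarrow> (real \<Rightarrow> 'a \<Rightarrow> real) \<Rightarrow> (real \<Rightarrow> 'a \<Rightarrow> real) \<Rightarrow> bool" where
  "OU_equation M a z u \<longleftrightarrow>
     (\<forall>t. u t \<in> borel_measurable M) \<and>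
     (AE \<omega> in M. \<forall>s t. s \<le> t \<longrightarrow>
        (\<lambda>r. u r \<omega>) integrable_on {s..t} \<and>
        u t \<omega> - u s \<omega> =
          - a * integral {s..t} (\<lambda>r. u r \<omega>) + (z (a * t) \<omega> - z (a * s) \<omega>))"

definition non_gaussian_OU_process ::
    "'a measure \<Rightarrow> real \<Rightarrow> (real \<Rightarrow> 'a \<Rightarrow> real) \<Rightarrow> (real \<Rightarrow> 'a \<Rightarrow> real) \<Rightarrow> bool" where
  "non_gaussian_OU_process M a z u \<longleftrightarrow>
     OU_equation M a z u \<and> strictly_stationary M u \<and> \<not> gaussian_process M u"

end

theory Submission
  imports Defs
begin

text \<open>
  For \<open>s < t\<close> put \<open>c = e\<^bsup>-a(t-s)\<^esup>\<close>, \<open>X = u(s)\<close> and \<open>W = u(t) - c u(s)\<close>.  Summation by parts along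
  a fine mesh exhibits \<open>u(s) - e\<^bsup>-a(s-r)\<^esup> u(r)\<close> and \<open>W\<close> as almost sure limits of linear combinations
  of disjoint increments of \<open>z\<close>, hence as independent; as \<open>r \<rightarrow> -\<infinity>\<close>, stationarity makes \<open>X\<close> and \<open>W\<close>
  independent.  Since \<open>X\<close> and \<open>cX + W\<close> have the same tail \<open>G\<close> of exponential rate \<open>\<beta>\<close>, all exponential
  moments of order below \<open>\<beta>\<close> of \<open>X\<close> and \<open>W\<close> are finite, and Chernoff's bound with the weights
  \<open>(1-c)\<theta>\<close> on \<open>X\<close> and \<open>\<theta>\<close> on \<open>cX + W\<close>, \<open>\<theta> < \<beta>\<close>, shows that \<open>P(X > x, cX + W > x)\<close> decays at least
  at rate \<open>(2-c)\<beta>\<close>.  Conversely this probability is at least \<open>G(x) P(W > (1-c)x)\<close>, and \<open>W\<close> has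
  tail rate \<open>\<beta>\<close> because the tail of \<open>cX\<close> is lighter.  Hence the joint exceedance probability has
  logarithmic order \<open>G(x)\<^bsup>2-c\<^esup>\<close>.
\<close>

section \<open>Paths of the Langevin equation\<close>

text \<open>One-sided limits bound \<open>f\<close> near each point, and bounds on adjacent
  intervals combine; bisection makes this local bound uniform on a compact interval.\<close>

lemma cadlag_bounded:
  assumes "cadlag f"
  shows "\<exists>B. \<forall>x\<in>{a..b}. \<bar>f x\<bar> \<le> B"
proof (cases "a \<le> b")
  case True
  then show ?thesis
  proof (induction rule: Bolzano)
    case (trans a b c)
    then obtain B C where "\<forall>x\<in>{a..b}. \<bar>f x\<bar> \<le> B" "\<forall>x\<in>{b..c}. \<bar>f x\<bar> \<le> C" by blast
    then have "\<forall>x\<in>{a..c}. \<bar>f x\<bar> \<le> max B C"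
      by (metis atLeastAtMost_iff le_max_iff_disj linorder_le_cases)
    then show ?case by blast
  next
    case (local x)
    from assms obtain l where l: "(f \<longlongrightarrow> l) (at_left x)" and r: "(f \<longlongrightarrow> f x) (at_right x)"
      unfolding cadlag_def continuous_within by blast
    have "\<forall>\<^sub>F y in at_left x. dist (f y) l < 1" "\<forall>\<^sub>F y in at_right x. dist (f y) (f x) < 1"
      using tendstoD[OF l, of 1] tendstoD[OF r, of 1] by simp_all
    then obtain c d where cd: "c < x" "x < d"
      "\<And>y. c < y \<Longrightarrow> y < x \<Longrightarrow> dist (f y) l < 1" "\<And>y. x < y \<Longrightarrow> y < d \<Longrightarrow> dist (f y) (f x) < 1"
      unfolding eventually_at_left_field eventually_at_right_field by blast
    define B where "B = max (\<bar>l\<bar> + 1) (\<bar>f x\<bar> + 1)"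
    have B: "\<bar>f y\<bar> \<le> B" if "c < y" "y < d" for y
    proof -
      have "y = x \<or> \<bar>f y - l\<bar> < 1 \<or> \<bar>f y - f x\<bar> < 1"
        using cd(3)[of y] cd(4)[of y] that unfolding dist_real_def by (cases y x rule: linorder_cases) auto
      then show ?thesis unfolding B_def by auto
    qed
    show ?case
    proof (rule exI[of _ "min (x - c) (d - x)"], safe)
      fix p q assume "p \<le> x" "x \<le> q" "q - p < min (x - c) (d - x)"
      then have "\<forall>y\<in>{p..q}. \<bar>f y\<bar> \<le> B" by (auto intro!: B)
      then show "\<exists>B. \<forall>y\<in>{p..q}. \<bar>f y\<bar> \<le> B" ..
    qed (use cd in auto)
  qed
qed auto

lemma has_integral_sum_intervals:
  fixes f :: "real \<Rightarrow> real" and t :: "nat \<Rightarrow> real"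
  assumes "\<And>i. i < m \<Longrightarrow> (f has_integral I i) {t i..t (Suc i)}"
    and "\<And>i. i < m \<Longrightarrow> t i \<le> t (Suc i)"
  shows "(f has_integral (\<Sum>i<m. I i)) {t 0..t m}"
  using assms
proof (induction m)
  case (Suc m)
  have "t 0 \<le> t i" if "i \<le> m" for i
    using that
  proof (induction i)
    case (Suc i)
    then show ?case using Suc.prems \<open>\<And>i. i < Suc m \<Longrightarrow> t i \<le> t (Suc i)\<close>[of i] by auto
  qed simp
  then show ?case
    using has_integral_combine[of "t 0" "t m" "t (Suc m)" f] Suc by simp
qed (simp add: has_integral_refl)

section \<open>Summation by parts along equidistant meshes\<close>

text \<open>Taking \<open>Suc n\<close> cells keeps the denominator nonzero, so every
  \<open>n\<close> yields a genuine partition when \<open>r < s\<close>.\<close>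

definition mesh :: "real \<Rightarrow> real \<Rightarrow> nat \<Rightarrow> nat \<Rightarrow> real" where
  "mesh r s n i = r + (s - r) * real i / real (Suc n)"

lemma mesh_0 [simp]: "mesh r s n 0 = r"
  by (simp add: mesh_def)

lemma mesh_Suc_eq [simp]: "mesh r s n (Suc n) = s"
  unfolding mesh_def by simp

lemma mesh_less: "r < s \<Longrightarrow> i < j \<Longrightarrow> mesh r s n i < mesh r s n j"
  unfolding mesh_def by (simp add: divide_strict_right_mono)

text \<open>One fixed sample path: \<open>f\<close> is the path of \<open>u\<close>, and
  \<open>g\<close> is the time-changed noise path \<open>t \<mapsto> z (a * t)\<close>.\<close>

locale langevin_path =
  fixes a :: real and f g :: "real \<Rightarrow> real"
  assumes cadlag_noise: "cadlag g"
    and integrable: "x \<le> y \<Longrightarrow> f integrable_on {x..y}"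
    and equation: "x \<le> y \<Longrightarrow> f y - f x = - a * integral {x..y} f + (g y - g x)"
begin

lemma path_eq: "x \<le> y \<Longrightarrow> f y = f x - a * integral {x..y} f + (g y - g x)"
  using equation[of x y] by simp

text \<open>The indefinite integral is continuous, so \<open>f\<close> inherits right continuity
  from \<open>g\<close> through the integrated equation.\<close>

lemma path_right_continuous: "(f \<longlongrightarrow> f x) (at_right x)"
proof -
  have "continuous_on {x..x+1} (\<lambda>y. integral {x..y} f)"
    by (intro indefinite_integral_continuous_1 integrable) simp
  then have "((\<lambda>y. integral {x..y} f) \<longlongrightarrow> integral {x..x} f) (at x within {x..x+1})"
    unfolding continuous_on_def by fastforce
  then have "((\<lambda>y. integral {x..y} f) \<longlongrightarrow> 0) (at_right x)"
    by (simp add: at_within_Icc_at_right)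
  moreover have "(g \<longlongrightarrow> g x) (at_right x)"
    using cadlag_noise unfolding cadlag_def continuous_within by blast
  ultimately have "((\<lambda>y. f x - a * integral {x..y} f + (g y - g x)) \<longlongrightarrow> f x - a * 0 + (g x - g x)) (at_right x)"
    by (intro tendsto_intros)
  moreover have "\<forall>\<^sub>F y in at_right x. f x - a * integral {x..y} f + (g y - g x) = f y"
    by (auto simp: eventually_at_right_field intro!: exI[of _ "x+1"] path_eq[symmetric])
  ultimately show ?thesis
    by (simp add: tendsto_cong)
qed

text \<open>The noise is bounded and the indefinite integral is continuous on a compact interval.
  This supplies the dominating constant for the mesh sums.\<close>

lemma path_bounded: "\<exists>B. \<forall>x\<in>{p..q}. \<bar>f x\<bar> \<le> B"
proof (cases "p \<le> q")
  case True
  obtain C where C: "\<And>x. x \<in> {p..q} \<Longrightarrow> \<bar>g x\<bar> \<le> C"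
    using cadlag_bounded[OF cadlag_noise, of p q] by blast
  have "continuous_on {p..q} (\<lambda>y. integral {p..y} f)"
    by (intro indefinite_integral_continuous_1 integrable True)
  then have "bounded ((\<lambda>y. integral {p..y} f) ` {p..q})"
    by (intro compact_imp_bounded compact_continuous_image compact_Icc)
  then obtain D where D: "\<And>x. x \<in> {p..q} \<Longrightarrow> \<bar>integral {p..x} f\<bar> \<le> D"
    unfolding bounded_real by blast
  have "\<bar>f x\<bar> \<le> \<bar>f p\<bar> + \<bar>a\<bar> * D + 2 * C" if "x \<in> {p..q}" for x
  proof -
    have "\<bar>a * integral {p..x} f\<bar> \<le> \<bar>a\<bar> * D"
      using D[OF that] by (simp add: abs_mult mult_left_mono)
    then show ?thesis
      using path_eq[of p x] C[OF that] C[of p] that by auto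
  qed
  then show ?thesis by blast
qed auto

text \<open>
  Summation by parts leaves a remainder in which \<open>f\<close> is sampled at right end points only, so right
  continuity alone makes its integrand \<open>\<phi>\<close> converge to \<open>0\<close> at every point, jumps included.
\<close>

lemma sum_mesh_tendsto:
  assumes "r < s"
  shows "(\<lambda>n. \<Sum>i<Suc n. exp (- a * (s - mesh r s n i)) * (g (mesh r s n (Suc i)) - g (mesh r s n i)))
    \<longlonglongrightarrow> f s - exp (- a * (s - r)) * f r"
proof -
  define E where "E x = exp (- a * (s - x))" for x
  define d where "d n = (s - r) / real (Suc n)" for n
  \<comment> \<open>Cells are half open: a mesh point belongs to the cell on its right. Hence
    \<open>right n v\<close> lies strictly above \<open>v\<close>, as convergence along
    \<open>at_right\<close> requires.\<close>
  define k where "k n v = \<lfloor>(v - r) / d n\<rfloor>" for n v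
  define left right where "left n v = r + of_int (k n v) * d n" and "right n v = left n v + d n" for n v
  define \<phi> where "\<phi> n v = a * E v * f (right n v) - a * E (left n v) * f v" for n v
  let ?t = "mesh r s"
  \<comment> \<open>\<open>J n i\<close> is what the discrete product rule leaves over: the
    increment of \<open>E * f\<close> across the cell minus the left value of \<open>E\<close> times
    the increment of \<open>g\<close>.\<close>
  define J where "J n i = (E (?t n (Suc i)) - E (?t n i)) * f (?t n (Suc i))
      - a * E (?t n i) * integral {?t n i..?t n (Suc i)} f" for n i
  have d: "d n > 0" for n using assms by (simp add: d_def)
  have t: "?t n i = r + real i * d n" for n i by (simp add: mesh_def d_def)
  have k: "of_int (k n v) * d n \<le> v - r" "v - r < (of_int (k n v) + 1) * d n" for n v
    unfolding k_def using d[of n]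
    by (simp_all add: pos_le_divide_eq[symmetric] pos_divide_less_eq[symmetric])
  have left: "left n v \<le> v" "v - d n \<le> left n v" and right: "v < right n v" "right n v \<le> v + d n" for n v
    using k[where n=n and v=v] unfolding left_def right_def by (auto simp: algebra_simps)
  have k_eq: "k n v = int i" if "?t n i \<le> v" "v < ?t n (Suc i)" for n i v
    unfolding k_def using that d[of n]
    by (intro floor_unique) (auto simp: t pos_le_divide_eq pos_divide_less_eq algebra_simps)
  have J: "(\<phi> n has_integral J n i) {?t n i..?t n (Suc i)}" for n i
  proof -
    let ?x = "?t n i" and ?y = "?t n (Suc i)"
    have xy: "?x \<le> ?y" using d[of n] by (simp add: t algebra_simps)
    have "(E has_vector_derivative a * E v) (at v within {?x..?y})" for v
      unfolding E_def by (auto intro!: derivative_eq_intros simp flip: has_real_derivative_iff_has_vector_derivative)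
    then have "((\<lambda>v. a * E v) has_integral (E ?y - E ?x)) {?x..?y}"
      by (intro fundamental_theorem_of_calculus xy)
    then have "((\<lambda>v. a * E v * f ?y - a * E ?x * f v) has_integral J n i) {?x..?y}"
      unfolding J_def
      by (intro has_integral_diff has_integral_mult_left has_integral_mult_right
          integrable_integral integrable xy)
    then show ?thesis
    proof (rule has_integral_spike_finite[rotated -1])
      \<comment> \<open>The right end point \<open>?y\<close> already belongs to the next cell and
        is discarded as a null set.\<close>
      fix v assume "v \<in> {?x..?y} - {?y}"
      then have "k n v = int i" by (intro k_eq) auto
      then have "left n v = ?x" "right n v = ?y"
        unfolding left_def right_def by (simp_all add: t algebra_simps)
      then show "\<phi> n v = a * E v * f ?y - a * E ?x * f v" by (simp add: \<phi>_def)
    qed simp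
  qed
  have \<phi>: "(\<phi> n has_integral (\<Sum>i<Suc n. J n i)) {r..s}" for n
    using has_integral_sum_intervals[of "Suc n" "\<phi> n" "J n" "?t n"] J mesh_less[OF assms]
    by (simp add: less_imp_le)
  have d0: "d \<longlonglongrightarrow> 0"
    unfolding d_def by (intro LIMSEQ_Suc lim_const_over_n)
  have left_lim: "(\<lambda>n. left n v) \<longlonglongrightarrow> v" and right_lim: "(\<lambda>n. right n v) \<longlonglongrightarrow> v" for v
  proof -
    have "(\<lambda>n. v - d n) \<longlonglongrightarrow> v - 0" "(\<lambda>n. v + d n) \<longlonglongrightarrow> v + 0"
      by (intro tendsto_intros d0)+
    then have lim: "(\<lambda>n. v - d n) \<longlonglongrightarrow> v" "(\<lambda>n. v + d n) \<longlonglongrightarrow> v" by simp_all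
    show "(\<lambda>n. left n v) \<longlonglongrightarrow> v"
      by (rule tendsto_sandwich[OF _ _ lim(1) tendsto_const]) (simp_all add: left)
    show "(\<lambda>n. right n v) \<longlonglongrightarrow> v"
      by (rule tendsto_sandwich[OF _ _ tendsto_const lim(2)]) (simp_all add: right less_imp_le)
  qed
  have pointwise: "(\<lambda>n. \<phi> n v) \<longlonglongrightarrow> 0" for v
  proof -
    have "filterlim (\<lambda>n. right n v) (at_right v) sequentially"
      by (simp add: filterlim_at right right_lim less_imp_neq[OF right(1), symmetric])
    then have "(\<lambda>n. f (right n v)) \<longlonglongrightarrow> f v"
      by (rule filterlim_compose[OF path_right_continuous])
    then have "(\<lambda>n. \<phi> n v) \<longlonglongrightarrow> a * E v * f v - a * E v * f v"
      unfolding \<phi>_def E_def by (intro tendsto_intros left_lim)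
    then show ?thesis by simp
  qed
  \<comment> \<open>\<open>right n v\<close> may overshoot \<open>s\<close>, but by at most
    \<open>d n \<le> s - r\<close>, so \<open>f\<close> is bounded on an enlarged interval.\<close>
  define R where "R = s + (s - r)"
  obtain B where B: "\<And>x. x \<in> {r..R} \<Longrightarrow> \<bar>f x\<bar> \<le> B"
    using path_bounded[of r R] by blast
  have bound: "norm (\<phi> n v) \<le> 2 * (\<bar>a\<bar> * exp (\<bar>a\<bar> * (s - r)) * B)" if v: "v \<in> {r..s}" for n v
  proof -
    have "d n \<le> s - r" unfolding d_def using assms by (simp add: pos_divide_le_eq)
    then have r_in: "right n v \<in> {r..R}" "v \<in> {r..R}"
      using right[where n=n and v=v] v assms unfolding R_def by auto
    have "k n v \<ge> 0" unfolding k_def using v d[of n] by (simp add: divide_nonneg_pos)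
    then have "left n v \<ge> r" unfolding left_def using d[of n] by simp
    then have l_in: "left n v \<in> {r..s}" using left[where n=n and v=v] v by auto
    have E: "\<bar>E w\<bar> \<le> exp (\<bar>a\<bar> * (s - r))" if "w \<in> {r..s}" for w
    proof -
      have "- a * (s - w) \<le> \<bar>a\<bar> * (s - w)" using that by (intro mult_right_mono) auto
      also have "\<dots> \<le> \<bar>a\<bar> * (s - r)" using that by (intro mult_left_mono) auto
      finally show ?thesis unfolding E_def by simp
    qed
    have "\<bar>a * E v * f (right n v)\<bar> \<le> \<bar>a\<bar> * exp (\<bar>a\<bar> * (s - r)) * B"
      unfolding abs_mult by (intro mult_mono B E r_in v) auto
    moreover have "\<bar>a * E (left n v) * f v\<bar> \<le> \<bar>a\<bar> * exp (\<bar>a\<bar> * (s - r)) * B"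
      unfolding abs_mult by (intro mult_mono B E r_in l_in) auto
    ultimately show ?thesis unfolding \<phi>_def real_norm_def by linarith
  qed
  have "(\<lambda>n. integral {r..s} (\<phi> n)) \<longlonglongrightarrow> integral {r..s} (\<lambda>_. 0)"
    by (rule dominated_convergence(2)[where h="\<lambda>_. 2 * (\<bar>a\<bar> * exp (\<bar>a\<bar> * (s - r)) * B)"])
      (use \<phi> bound pointwise in auto)
  then have "(\<lambda>n. \<Sum>i<Suc n. J n i) \<longlonglongrightarrow> 0"
    by (simp add: integral_unique[OF \<phi>] del: sum.lessThan_Suc)
  then have "(\<lambda>n. (f s - exp (- a * (s - r)) * f r) - (\<Sum>i<Suc n. J n i)) \<longlonglongrightarrow> (f s - exp (- a * (s - r)) * f r) - 0"
    by (intro tendsto_intros)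
  moreover have "(f s - exp (- a * (s - r)) * f r) - (\<Sum>i<Suc n. J n i)
     = (\<Sum>i<Suc n. E (?t n i) * (g (?t n (Suc i)) - g (?t n i)))" for n
  proof -
    have g_inc: "g (?t n (Suc i)) - g (?t n i) = f (?t n (Suc i)) - f (?t n i) + a * integral {?t n i..?t n (Suc i)} f" for i
      using equation[of "?t n i" "?t n (Suc i)"] mesh_less[OF assms, of i "Suc i" n] by simp
    have "E (?t n (Suc i)) * f (?t n (Suc i)) - E (?t n i) * f (?t n i) - J n i
        = E (?t n i) * (g (?t n (Suc i)) - g (?t n i))" for i
      unfolding J_def g_inc by (simp add: algebra_simps)
    moreover have "(f s - exp (- a * (s - r)) * f r) = (\<Sum>i<Suc n. E (?t n (Suc i)) * f (?t n (Suc i)) - E (?t n i) * f (?t n i))"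
      by (subst sum_lessThan_telescope) (simp add: E_def)
    ultimately show ?thesis
      by (simp only: sum_subtractf[symmetric])
  qed
  ultimately show ?thesis unfolding E_def by simp
qed

end

section \<open>Independence under almost sure limits\<close>

lemma cts_step_ge0: "a < b \<Longrightarrow> 0 \<le> cts_step a b x" and cts_step_le1: "a < b \<Longrightarrow> cts_step a b x \<le> 1"
  by (auto simp: cts_step_def)

lemma continuous_cts_step: "a < b \<Longrightarrow> continuous_on UNIV (cts_step a b)"
  by (intro uniformly_continuous_imp_continuous cts_step_uniformly_continuous)

lemma measurable_cts_step: "a < b \<Longrightarrow> cts_step a b \<in> borel_measurable borel"
  by (intro borel_measurable_continuous_onI continuous_cts_step)

text \<open>The steps equal 1 at \<open>a\<close> itself and descend to its right, so the limit is
  the indicator of the closed half-line.\<close>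

lemma cts_step_tendsto_indicator:
  "(\<lambda>n. cts_step a (a + 1 / real (Suc n)) x) \<longlonglongrightarrow> indicator {..a} x"
proof (cases "x \<le> a")
  case True
  then show ?thesis by (simp add: cts_step_def)
next
  case False
  have "(\<lambda>n. a + 1 / real (Suc n)) \<longlonglongrightarrow> a + 0"
    by (intro tendsto_intros LIMSEQ_Suc lim_1_over_n)
  then have "\<forall>\<^sub>F n in sequentially. a + 1 / real (Suc n) < x"
    using False by (intro order_tendstoD) auto
  then have "\<forall>\<^sub>F n in sequentially. cts_step a (a + 1 / real (Suc n)) x = indicator {..a} x"
    by eventually_elim (use False in \<open>auto simp: cts_step_def\<close>)
  then show ?thesis by (rule tendsto_eventually)
qed

context prob_space
begin

text \<open>Closed half-lines generate the Borel sets and are stable under intersection, so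
  independence of their preimages extends to the generated sigma-algebras.\<close>

lemma indep_var_atMostI:
  fixes X Y :: "'a \<Rightarrow> real"
  assumes [measurable]: "random_variable borel X" "random_variable borel Y"
    and prod: "\<And>x y. prob {\<omega>\<in>space M. X \<omega> \<le> x \<and> Y \<omega> \<le> y}
      = prob {\<omega>\<in>space M. X \<omega> \<le> x} * prob {\<omega>\<in>space M. Y \<omega> \<le> y}"
  shows "indep_var borel X borel Y"
proof -
  define H where "H Z = range (\<lambda>z::real. {\<omega>\<in>space M. Z \<omega> \<le> z})" for Z :: "'a \<Rightarrow> real"
  have gen: "sigma_sets (space M) {Z -` A \<inter> space M |A. A \<in> sets borel} = sigma_sets (space M) (H Z)"
    for Z :: "'a \<Rightarrow> real"
  proof -
    have "{Z -` A \<inter> space M |A. A \<in> sets (borel::real measure)}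
        = {Z -` A \<inter> space M |A. A \<in> sigma_sets UNIV (range (\<lambda>a::real. {..a}))}"
      by (subst borel_eq_atMost) auto
    also have "\<dots> = sigma_sets (space M) {Z -` A \<inter> space M |A. A \<in> range (\<lambda>a::real. {..a})}"
      by (rule sigma_sets_vimage_commute) auto
    also have "{Z -` A \<inter> space M |A. A \<in> range (\<lambda>a::real. {..a})} = H Z"
    proof (intro set_eqI iffI)
      fix S assume "S \<in> H Z"
      then obtain z where "S = Z -` {..z} \<inter> space M" unfolding H_def by auto
      then show "S \<in> {Z -` A \<inter> space M |A. A \<in> range (\<lambda>a::real. {..a})}" by blast
    qed (auto simp: H_def)
    finally show ?thesis
      by (simp add: sigma_sets_sigma_sets_eq H_def subset_eq)
  qed
  have stable: "Int_stable (H Z)" for Z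
  proof (rule Int_stableI)
    fix A B assume "A \<in> H Z" "B \<in> H Z"
    then obtain x y where "A = {\<omega>\<in>space M. Z \<omega> \<le> x}" "B = {\<omega>\<in>space M. Z \<omega> \<le> y}"
      unfolding H_def by blast
    then have "A \<inter> B = {\<omega>\<in>space M. Z \<omega> \<le> min x y}" by auto
    then show "A \<inter> B \<in> H Z" unfolding H_def by blast
  qed
  have "indep_set (H X) (H Y)"
  proof (rule indep_setI)
    fix A B assume "A \<in> H X" "B \<in> H Y"
    then obtain x y where "A = {\<omega>\<in>space M. X \<omega> \<le> x}" "B = {\<omega>\<in>space M. Y \<omega> \<le> y}"
      unfolding H_def by blast
    moreover have "{\<omega>\<in>space M. X \<omega> \<le> x} \<inter> {\<omega>\<in>space M. Y \<omega> \<le> y} = {\<omega>\<in>space M. X \<omega> \<le> x \<and> Y \<omega> \<le> y}"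
      by auto
    ultimately show "prob (A \<inter> B) = prob A * prob B" using prod by simp
  qed (auto simp: H_def)
  then show ?thesis
    unfolding indep_var_eq gen by (simp add: indep_set_sigma_sets stable)
qed

text \<open>Indicators are discontinuous and need not follow an almost sure limit. The product
  formula is therefore passed to the limit in \<open>n\<close> for continuous steps first;
  afterwards the steps shrink to indicators. Both limits are dominated by 1.\<close>

lemma indep_var_AE_limit:
  fixes X Y :: "nat \<Rightarrow> 'a \<Rightarrow> real" and X' Y' :: "'a \<Rightarrow> real"
  assumes indep: "\<And>n. indep_var borel (X n) borel (Y n)"
    and [measurable]: "random_variable borel X'" "random_variable borel Y'"
    and X: "AE \<omega> in M. (\<lambda>n. X n \<omega>) \<longlonglongrightarrow> X' \<omega>" and Y: "AE \<omega> in M. (\<lambda>n. Y n \<omega>) \<longlonglongrightarrow> Y' \<omega>"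
  shows "indep_var borel X' borel Y'"
proof (rule indep_var_atMostI)
  fix x y
  have [measurable]: "random_variable borel (X n)" "random_variable borel (Y n)" for n
    using indep_var_rv1[OF indep] indep_var_rv2[OF indep] by auto
  define f where "f k = cts_step x (x + 1 / real (Suc k))" for k
  define g where "g k = cts_step y (y + 1 / real (Suc k))" for k
  have fg: "continuous_on UNIV (f k)" "continuous_on UNIV (g k)"
    "0 \<le> f k v" "f k v \<le> 1" "0 \<le> g k v" "g k v \<le> 1" for k v
    unfolding f_def g_def by (auto intro!: continuous_cts_step cts_step_ge0 cts_step_le1)
  have [measurable]: "f k \<in> borel_measurable borel" "g k \<in> borel_measurable borel" for k
    by (intro borel_measurable_continuous_onI fg)+
  have le1: "\<bar>f k v * g k w\<bar> \<le> 1" for k v w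
    using fg[of k] by (simp add: abs_mult mult_le_one)
  have eq: "(\<integral>\<omega>. f k (X' \<omega>) * g k (Y' \<omega>) \<partial>M) = (\<integral>\<omega>. f k (X' \<omega>) \<partial>M) * (\<integral>\<omega>. g k (Y' \<omega>) \<partial>M)" for k
  proof (rule LIMSEQ_unique)
    have fX: "AE \<omega> in M. (\<lambda>n. f k (X n \<omega>)) \<longlonglongrightarrow> f k (X' \<omega>)"
      using X by eventually_elim (rule continuous_on_tendsto_compose[OF fg(1)], auto)
    have gY: "AE \<omega> in M. (\<lambda>n. g k (Y n \<omega>)) \<longlonglongrightarrow> g k (Y' \<omega>)"
      using Y by eventually_elim (rule continuous_on_tendsto_compose[OF fg(2)], auto)
    show "(\<lambda>n. \<integral>\<omega>. f k (X n \<omega>) * g k (Y n \<omega>) \<partial>M) \<longlonglongrightarrow> (\<integral>\<omega>. f k (X' \<omega>) * g k (Y' \<omega>) \<partial>M)"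
    proof (rule integral_dominated_convergence[where w="\<lambda>_. 1"])
      show "AE \<omega> in M. (\<lambda>n. f k (X n \<omega>) * g k (Y n \<omega>)) \<longlonglongrightarrow> f k (X' \<omega>) * g k (Y' \<omega>)"
        using fX gY by eventually_elim (rule tendsto_mult)
    qed (auto simp: le1)
    have "(\<lambda>n. (\<integral>\<omega>. f k (X n \<omega>) \<partial>M) * (\<integral>\<omega>. g k (Y n \<omega>) \<partial>M))
        \<longlonglongrightarrow> (\<integral>\<omega>. f k (X' \<omega>) \<partial>M) * (\<integral>\<omega>. g k (Y' \<omega>) \<partial>M)"
      using fg by (intro tendsto_mult integral_dominated_convergence[where w="\<lambda>_. 1"] fX gY) auto
    moreover have "(\<integral>\<omega>. f k (X n \<omega>) * g k (Y n \<omega>) \<partial>M) = (\<integral>\<omega>. f k (X n \<omega>) \<partial>M) * (\<integral>\<omega>. g k (Y n \<omega>) \<partial>M)" for n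
    proof (rule indep_var_lebesgue_integral)
      show "indep_var borel (\<lambda>\<omega>. f k (X n \<omega>)) borel (\<lambda>\<omega>. g k (Y n \<omega>))"
        using indep_var_compose[OF indep[of n], of "f k" borel "g k" borel] by (simp add: comp_def)
      show "integrable M (\<lambda>\<omega>. f k (X n \<omega>))" "integrable M (\<lambda>\<omega>. g k (Y n \<omega>))"
        using fg by (auto intro!: integrable_const_bound[where B=1])
    qed
    ultimately show "(\<lambda>n. \<integral>\<omega>. f k (X n \<omega>) * g k (Y n \<omega>) \<partial>M)
        \<longlonglongrightarrow> (\<integral>\<omega>. f k (X' \<omega>) \<partial>M) * (\<integral>\<omega>. g k (Y' \<omega>) \<partial>M)" by simp
  qed
  have "(\<integral>\<omega>. indicator {..x} (X' \<omega>) * indicator {..y} (Y' \<omega>) \<partial>M)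
      = (\<integral>\<omega>. indicator {..x} (X' \<omega>) \<partial>M) * (\<integral>\<omega>. indicator {..y} (Y' \<omega>) \<partial>M :: real)"
  proof (rule LIMSEQ_unique)
    have fX: "AE \<omega> in M. (\<lambda>k. f k (X' \<omega>)) \<longlonglongrightarrow> indicator {..x} (X' \<omega>)"
      and gY: "AE \<omega> in M. (\<lambda>k. g k (Y' \<omega>)) \<longlonglongrightarrow> indicator {..y} (Y' \<omega>)"
      unfolding f_def g_def by (auto simp del: of_nat_Suc intro!: cts_step_tendsto_indicator)
    show "(\<lambda>k. \<integral>\<omega>. f k (X' \<omega>) * g k (Y' \<omega>) \<partial>M)
        \<longlonglongrightarrow> (\<integral>\<omega>. indicator {..x} (X' \<omega>) * indicator {..y} (Y' \<omega>) \<partial>M)"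
    proof (rule integral_dominated_convergence[where w="\<lambda>_. 1"])
      show "AE \<omega> in M. (\<lambda>k. f k (X' \<omega>) * g k (Y' \<omega>)) \<longlonglongrightarrow> indicator {..x} (X' \<omega>) * indicator {..y} (Y' \<omega>)"
        using fX gY by eventually_elim (rule tendsto_mult)
    qed (auto simp: le1)
    show "(\<lambda>k. \<integral>\<omega>. f k (X' \<omega>) * g k (Y' \<omega>) \<partial>M)
        \<longlonglongrightarrow> (\<integral>\<omega>. indicator {..x} (X' \<omega>) \<partial>M) * (\<integral>\<omega>. indicator {..y} (Y' \<omega>) \<partial>M)"
      unfolding eq using fg
      by (intro tendsto_mult integral_dominated_convergence[where w="\<lambda>_. 1"] fX gY) auto
  qed
  moreover have "(\<integral>\<omega>. indicator {..x} (X' \<omega>) * indicator {..y} (Y' \<omega>) \<partial>M :: real)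
      = (\<integral>\<omega>. indicator {\<omega>\<in>space M. X' \<omega> \<le> x \<and> Y' \<omega> \<le> y} \<omega> \<partial>M)"
    "(\<integral>\<omega>. indicator {..x} (X' \<omega>) \<partial>M :: real) = (\<integral>\<omega>. indicator {\<omega>\<in>space M. X' \<omega> \<le> x} \<omega> \<partial>M)"
    "(\<integral>\<omega>. indicator {..y} (Y' \<omega>) \<partial>M :: real) = (\<integral>\<omega>. indicator {\<omega>\<in>space M. Y' \<omega> \<le> y} \<omega> \<partial>M)"
    by (intro Bochner_Integration.integral_cong; auto split: split_indicator)+
  ultimately show "prob {\<omega>\<in>space M. X' \<omega> \<le> x \<and> Y' \<omega> \<le> y}
      = prob {\<omega>\<in>space M. X' \<omega> \<le> x} * prob {\<omega>\<in>space M. Y' \<omega> \<le> y}"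
    by simp
qed (fact assms)+

end

section \<open>Tail rates\<close>

text \<open>At \<open>t = 0\<close> the ratio tends to 1, while a zero of \<open>G\<close> would
  give the quotient 0. So \<open>G\<close> is nonzero arbitrarily far out, and monotonicity carries
  positivity back to \<open>x\<close>.\<close>

lemma exponential_tail_pos:
  assumes "exponential_tail \<beta> G" "antimono G"
  shows "G x > 0"
proof -
  have "((\<lambda>x. G (x - 0) / G x) \<longlongrightarrow> exp (0 * \<beta>)) at_top"
    using assms unfolding exponential_tail_def by blast
  then have "\<forall>\<^sub>F x in at_top. G x / G x > 0"
    by (intro order_tendstoD) auto
  then obtain y where "y \<ge> x" "G y / G y > 0"
    using eventually_happens'[OF trivial_limit_at_top_linorder eventually_conj[OF _ eventually_ge_at_top]] by blast
  then have "G y \<noteq> 0" "G y \<le> G x" "0 \<le> G y"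
    using assms unfolding exponential_tail_def antimono_def by auto
  then show ?thesis by linarith
qed

lemma exponential_tail_step:
  assumes "exponential_tail \<beta> G"
  shows "((\<lambda>x. G (x + 1) / G x) \<longlongrightarrow> exp (- \<beta>)) at_top"
proof -
  have "((\<lambda>x. G (x - - 1) / G x) \<longlongrightarrow> exp (- 1 * \<beta>)) at_top"
    using assms unfolding exponential_tail_def by blast
  then show ?thesis by simp
qed

text \<open>Each unit step eventually multiplies \<open>G\<close> by more than
  \<open>exp (- \<theta>)\<close>. Iteration bounds \<open>G\<close> along \<open>b + n\<close>, and
  monotonicity fills in the remaining points.\<close>

lemma exponential_tail_lower:
  assumes G: "exponential_tail \<beta> G" "antimono G" and "\<theta> > \<beta>" "\<theta> \<ge> 0"
  shows "\<exists>C>0. \<forall>\<^sub>F x in at_top. C * exp (- \<theta> * x) \<le> G x"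
proof -
  have "\<forall>\<^sub>F x in at_top. G (x + 1) / G x > exp (- \<theta>)"
    using exponential_tail_step[OF G(1)] assms by (intro order_tendstoD) auto
  then obtain b where b: "\<And>x. x \<ge> b \<Longrightarrow> G (x + 1) / G x > exp (- \<theta>)"
    unfolding eventually_at_top_linorder by blast
  have step: "exp (- \<theta>) * G x \<le> G (x + 1)" if "x \<ge> b" for x
    using b[OF that] exponential_tail_pos[OF G, of x] by (simp add: pos_less_divide_eq)
  have iter: "exp (- \<theta> * real n) * G b \<le> G (b + real n)" for n
  proof (induction n)
    case (Suc n)
    have "exp (- \<theta> * real (Suc n)) * G b = exp (- \<theta>) * (exp (- \<theta> * real n) * G b)"
      by (simp add: algebra_simps flip: exp_add)
    also have "\<dots> \<le> exp (- \<theta>) * G (b + real n)" using Suc by simp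
    also have "\<dots> \<le> G (b + real n + 1)" by (rule step) simp
    finally show ?case by (simp add: algebra_simps)
  qed simp
  \<comment> \<open>Rounding \<open>x - b\<close> up to an integer costs at most one unit, which
    explains the factor \<open>exp (- \<theta> * (1 - b))\<close>.\<close>
  have "G b * exp (- \<theta> * (1 - b)) * exp (- \<theta> * x) \<le> G x" if "x \<ge> b" for x
  proof -
    define n where "n = nat \<lceil>x - b\<rceil>"
    have n: "x - b \<le> real n" "real n \<le> x - b + 1" using that unfolding n_def by linarith+
    have "\<theta> * real n \<le> \<theta> * (x - b + 1)" using n assms by (intro mult_left_mono) auto
    then have "exp (- \<theta> * (1 - b) + - \<theta> * x) \<le> exp (- \<theta> * real n)" by (simp add: algebra_simps)
    then have "G b * (exp (- \<theta> * (1 - b)) * exp (- \<theta> * x)) \<le> G b * exp (- \<theta> * real n)"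
      using exponential_tail_pos[OF G, of b] unfolding exp_add by (intro mult_left_mono) auto
    then have "G b * exp (- \<theta> * (1 - b)) * exp (- \<theta> * x) \<le> exp (- \<theta> * real n) * G b"
      by (simp only: mult_ac)
    also have "\<dots> \<le> G (b + real n)" by (rule iter)
    also have "\<dots> \<le> G x" using n assms(2) by (auto intro: antimonoD)
    finally show ?thesis .
  qed
  then show ?thesis
    using exponential_tail_pos[OF G, of b]
    by (intro exI[of _ "G b * exp (- \<theta> * (1 - b))"]) (auto simp: eventually_at_top_linorder)
qed

text \<open>Dividing the logarithm by \<open>x\<close> makes the constants \<open>C\<close> vanish,
  so bounds at all rates on either side of \<open>\<kappa>\<close> squeeze the quotient.\<close>

lemma ln_rate_tendsto:
  fixes h :: "real \<Rightarrow> real"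
  assumes "\<kappa> > 0"
    and upper: "\<And>\<theta>. 0 < \<theta> \<Longrightarrow> \<theta> < \<kappa> \<Longrightarrow> \<exists>C>0. \<forall>\<^sub>F x in at_top. h x \<le> C * exp (- \<theta> * x)"
    and lower: "\<And>\<theta>. \<kappa> < \<theta> \<Longrightarrow> \<exists>C>0. \<forall>\<^sub>F x in at_top. C * exp (- \<theta> * x) \<le> h x"
  shows "((\<lambda>x. ln (h x) / x) \<longlongrightarrow> - \<kappa>) at_top"
proof -
  have rate: "((\<lambda>x. ln (C * exp (- \<theta> * x)) / x) \<longlongrightarrow> - \<theta>) at_top" if "C > 0" for C \<theta> :: real
  proof -
    have "((\<lambda>x. ln C / x - \<theta>) \<longlongrightarrow> 0 - \<theta>) at_top"
      by (intro tendsto_diff tendsto_const tendsto_divide_0[OF tendsto_const] filterlim_at_top_imp_at_infinity filterlim_ident)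
    moreover have "\<forall>\<^sub>F x in at_top. ln C / x - \<theta> = ln (C * exp (- \<theta> * x)) / x"
      using eventually_gt_at_top[of 0]
      by eventually_elim (use that in \<open>simp add: ln_mult diff_divide_distrib\<close>)
    ultimately show ?thesis by (simp add: tendsto_cong)
  qed
  have pos: "\<forall>\<^sub>F x in at_top. h x > 0"
  proof -
    obtain C where "C > 0" "\<forall>\<^sub>F x in at_top. C * exp (- (\<kappa> + 1) * x) \<le> h x"
      using lower[of "\<kappa> + 1"] by auto
    from this(2) show ?thesis
      by eventually_elim (use \<open>C > 0\<close> in \<open>smt (verit) exp_gt_zero mult_pos_pos\<close>)
  qed
  have above: "\<forall>\<^sub>F x in at_top. y < ln (h x) / x" if "y < - \<kappa>" for y
  proof -
    \<comment> \<open>The midpoint of \<open>\<kappa>\<close> and \<open>- y\<close>.\<close>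
    define \<theta> where "\<theta> = (\<kappa> - y) / 2"
    have \<theta>: "\<kappa> < \<theta>" "y < - \<theta>" using that unfolding \<theta>_def by (simp_all add: field_simps)
    obtain C where C: "C > 0" "\<forall>\<^sub>F x in at_top. C * exp (- \<theta> * x) \<le> h x" using lower[OF \<theta>(1)] by auto
    show ?thesis
      using order_tendstoD(1)[OF rate[OF C(1)] \<theta>(2)] C(2) pos eventually_gt_at_top[of 0]
    proof eventually_elim
      case (elim x)
      have "ln (C * exp (- \<theta> * x)) / x \<le> ln (h x) / x"
        using elim C(1) by (intro divide_right_mono) auto
      then show ?case using elim by linarith
    qed
  qed
  have below: "\<forall>\<^sub>F x in at_top. ln (h x) / x < y" if "- \<kappa> < y" for y
  proof -
    \<comment> \<open>Again the midpoint; the alternative \<open>\<kappa> / 2\<close> keeps the rate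
      positive when \<open>y\<close> is large.\<close>
    define \<theta> where "\<theta> = max (\<kappa> / 2) ((\<kappa> - y) / 2)"
    have \<theta>: "0 < \<theta>" "\<theta> < \<kappa>" "- \<theta> < y" using that \<open>\<kappa> > 0\<close> unfolding \<theta>_def by (auto simp: field_simps max_def)
    obtain C where C: "C > 0" "\<forall>\<^sub>F x in at_top. h x \<le> C * exp (- \<theta> * x)" using upper[OF \<theta>(1,2)] by auto
    show ?thesis
      using order_tendstoD(2)[OF rate[OF C(1)] \<theta>(3)] C(2) pos eventually_gt_at_top[of 0]
    proof eventually_elim
      case (elim x)
      have "ln (h x) / x \<le> ln (C * exp (- \<theta> * x)) / x"
        using elim C(1) by (intro divide_right_mono) auto
      then show ?case using elim by linarith
    qed
  qed
  show ?thesis by (intro order_tendstoI above below)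
qed

section \<open>Exponential moments and products of independent variables\<close>

context prob_space
begin

text \<open>Cutting at integer levels bounds the moment by 1 plus the sum of the \<open>b n\<close>,
  whose successive ratios tend to \<open>exp (\<theta> - \<beta>) < 1\<close>.\<close>

lemma nn_integral_exp_finite:
  fixes X :: "'a \<Rightarrow> real"
  assumes [measurable]: "random_variable borel X"
    and tail: "\<And>x. prob {\<omega>\<in>space M. X \<omega> > x} = G x"
    and G: "exponential_tail \<beta> G" and \<theta>: "0 \<le> \<theta>" "\<theta> < \<beta>"
  shows "(\<integral>\<^sup>+\<omega>. ennreal (exp (\<theta> * X \<omega>)) \<partial>M) < \<infinity>"
proof -
  have anti: "antimono G"
    unfolding antimono_def tail[symmetric] by (auto intro!: finite_measure_mono)
  define b where "b n = exp (\<theta> * (real n + 1)) * G (real n)" for n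
  have G0: "G x > 0" for x by (rule exponential_tail_pos[OF G anti])
  have b0: "b n \<ge> 0" for n using G0[of "real n"] by (simp add: b_def)
  have "summable b"
  proof -
    \<comment> \<open>A number strictly between the limiting ratio
      \<open>exp (\<theta> - \<beta>)\<close> and 1.\<close>
    define r where "r = exp ((\<theta> - \<beta>) / 2)"
    have "((\<lambda>x. exp \<theta> * (G (x + 1) / G x)) \<longlongrightarrow> exp \<theta> * exp (- \<beta>)) at_top"
      by (intro tendsto_intros exponential_tail_step[OF G])
    then have "\<forall>\<^sub>F x in at_top. exp \<theta> * (G (x + 1) / G x) < r"
      using \<theta> by (intro order_tendstoD) (auto simp: r_def simp flip: exp_add)
    then obtain N where N: "\<And>x. x \<ge> N \<Longrightarrow> exp \<theta> * (G (x + 1) / G x) < r"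
      unfolding eventually_at_top_linorder by blast
    show ?thesis
    proof (rule summable_ratio_test)
      show "r < 1" using \<theta> by (simp add: r_def)
      fix n assume "n \<ge> nat \<lceil>N\<rceil>"
      then have "real n \<ge> N" by linarith
      then have "exp \<theta> * G (real n + 1) \<le> r * G (real n)"
        using N[of "real n"] G0[of "real n"] by (simp add: pos_divide_less_eq)
      then have "exp (\<theta> * (real n + 1)) * (exp \<theta> * G (real n + 1)) \<le> exp (\<theta> * (real n + 1)) * (r * G (real n))"
        by simp
      moreover have "b (Suc n) = exp (\<theta> * (real n + 1)) * (exp \<theta> * G (real n + 1))"
        unfolding b_def by (simp add: algebra_simps mult_exp_exp)
      ultimately have "b (Suc n) \<le> r * b n"
        unfolding b_def by (simp add: mult_ac)
      then show "norm (b (Suc n)) \<le> r * norm (b n)"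
        using b0[of n] b0[of "Suc n"] by simp
    qed
  qed
  \<comment> \<open>The event \<open>X > n\<close> replaces the layer
    \<open>n < X \<le> n + 1\<close>; this overcounts, but involves only the tail
    \<open>G\<close>.\<close>
  have "ennreal (exp (\<theta> * X \<omega>)) \<le> 1 + (\<Sum>n. ennreal (exp (\<theta> * (real n + 1))) * indicator {\<omega>\<in>space M. X \<omega> > real n} \<omega>)"
    (is "_ \<le> 1 + suminf ?s") if "\<omega> \<in> space M" for \<omega>
  proof (cases "X \<omega> \<le> 0")
    case True
    then have "exp (\<theta> * X \<omega>) \<le> 1" using \<theta> by (simp add: mult_nonneg_nonpos)
    then have "ennreal (exp (\<theta> * X \<omega>)) \<le> 1" by simp
    then show ?thesis by (simp add: add_increasing2)
  next
    case False
    define n where "n = nat (\<lceil>X \<omega>\<rceil> - 1)"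
    have n: "real n < X \<omega>" "X \<omega> \<le> real n + 1" using False unfolding n_def by linarith+
    then have "ennreal (exp (\<theta> * X \<omega>)) \<le> ennreal (exp (\<theta> * (real n + 1)))"
      using \<theta> by (auto intro!: ennreal_leI mult_left_mono)
    also have "\<dots> = ?s n" using n that by simp
    also have "\<dots> \<le> suminf ?s"
    proof -
      have "h n \<le> suminf h" for h :: "nat \<Rightarrow> ennreal"
        using sum_le_suminf[of h "{n}"] by simp
      then show ?thesis .
    qed
    finally show ?thesis by (simp add: add_increasing)
  qed
  then have "(\<integral>\<^sup>+\<omega>. ennreal (exp (\<theta> * X \<omega>)) \<partial>M)
      \<le> (\<integral>\<^sup>+\<omega>. 1 + (\<Sum>n. ennreal (exp (\<theta> * (real n + 1))) * indicator {\<omega>\<in>space M. X \<omega> > real n} \<omega>) \<partial>M)"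
    by (rule nn_integral_mono)
  also have "\<dots> = 1 + (\<Sum>n. ennreal (exp (\<theta> * (real n + 1))) * emeasure M {\<omega>\<in>space M. X \<omega> > real n})"
    by (simp add: nn_integral_add nn_integral_suminf nn_integral_cmult_indicator emeasure_space_1)
  also have "\<dots> = 1 + (\<Sum>n. ennreal (b n))"
    by (simp add: b_def emeasure_eq_measure tail ennreal_mult less_imp_le[OF G0])
  also have "(\<Sum>n. ennreal (b n)) = ennreal (suminf b)"
    by (intro suminf_ennreal_eq b0 summable_sums \<open>summable b\<close>)
  also have "1 + ennreal (suminf b) = ennreal (1 + suminf b)"
    using suminf_nonneg[OF \<open>summable b\<close> b0] by simp
  also have "\<dots> < \<infinity>" by simp
  finally show ?thesis .
qed

text \<open>The nonnegative form assumes no integrability, so finiteness of a factor can be read off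
  from finiteness of the product.\<close>

lemma nn_integral_indep_mult:
  fixes X Y :: "'a \<Rightarrow> real"
  assumes ind: "indep_var borel X borel Y"
    and [measurable]: "f \<in> borel_measurable borel" "g \<in> borel_measurable borel"
  shows "(\<integral>\<^sup>+\<omega>. f (X \<omega>) * g (Y \<omega>) \<partial>M) = (\<integral>\<^sup>+\<omega>. f (X \<omega>) \<partial>M) * (\<integral>\<^sup>+\<omega>. g (Y \<omega>) \<partial>M)"
proof -
  have [measurable]: "random_variable borel X" "random_variable borel Y"
    using ind indep_var_rv1 indep_var_rv2 by blast+
  interpret X: prob_space "distr M borel X" by (rule prob_space_distr) simp
  interpret Y: prob_space "distr M borel Y" by (rule prob_space_distr) simp
  interpret XY: pair_prob_space "distr M borel X" "distr M borel Y" ..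
  have "(\<integral>\<^sup>+\<omega>. f (X \<omega>) * g (Y \<omega>) \<partial>M) = (\<integral>\<^sup>+p. f (fst p) * g (snd p) \<partial>distr M (borel \<Otimes>\<^sub>M borel) (\<lambda>\<omega>. (X \<omega>, Y \<omega>)))"
    by (subst nn_integral_distr) auto
  also have "\<dots> = (\<integral>\<^sup>+p. f (fst p) * g (snd p) \<partial>(distr M borel X \<Otimes>\<^sub>M distr M borel Y))"
    using ind unfolding indep_var_distribution_eq by simp
  also have "\<dots> = (\<integral>\<^sup>+x. \<integral>\<^sup>+y. f x * g y \<partial>distr M borel Y \<partial>distr M borel X)"
    by (subst Y.nn_integral_fst[symmetric]) auto
  also have "\<dots> = (\<integral>\<^sup>+x. f x \<partial>distr M borel X) * (\<integral>\<^sup>+y. g y \<partial>distr M borel Y)"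
    by (simp add: nn_integral_cmult nn_integral_multc)
  finally show ?thesis by (simp add: nn_integral_distr)
qed

end

section \<open>Joint tail of one autoregressive step\<close>

text \<open>To be instantiated with \<open>X = u s\<close>, \<open>Y = u t\<close> and the
  innovation \<open>W\<close>. Stationarity is expressed by the common tail \<open>G\<close> of
  \<open>X\<close> and \<open>Y\<close>.\<close>

locale exponential_tail_autoregression = prob_space +
  fixes X Y W :: "'a \<Rightarrow> real" and c \<beta> :: real and G :: "real \<Rightarrow> real"
  assumes indep: "indep_var borel X borel W"
    and Y_measurable [measurable]: "random_variable borel Y"
    and Y_eq: "AE \<omega> in M. Y \<omega> = c * X \<omega> + W \<omega>"
    and c: "0 < c" "c < 1"
    and \<beta>: "\<beta> > 0"
    and tail_X: "prob {\<omega>\<in>space M. X \<omega> > x} = G x"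
    and tail_Y: "prob {\<omega>\<in>space M. Y \<omega> > x} = G x"
    and G: "exponential_tail \<beta> G"
begin

lemma X_measurable [measurable]: "random_variable borel X"
  and W_measurable [measurable]: "random_variable borel W"
  using indep indep_var_rv1 indep_var_rv2 by blast+

lemma G_antimono: "antimono G"
  unfolding antimono_def tail_X[symmetric] by (auto intro!: finite_measure_mono)

lemma G_pos: "G x > 0"
  by (rule exponential_tail_pos[OF G G_antimono])

lemma nn_integral_exp_X:
  assumes "0 \<le> \<theta>" "\<theta> < \<beta>"
  shows "(\<integral>\<^sup>+\<omega>. ennreal (exp (\<theta> * X \<omega>)) \<partial>M) < \<infinity>"
  by (rule nn_integral_exp_finite[OF _ tail_X G assms]) simp

text \<open>The finite moment of \<open>Y\<close> factors into the moments of \<open>c * X\<close>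
  and \<open>W\<close>.\<close>

lemma nn_integral_exp_W:
  assumes "0 \<le> \<theta>" "\<theta> < \<beta>"
  shows "(\<integral>\<^sup>+\<omega>. ennreal (exp (\<theta> * W \<omega>)) \<partial>M) < \<infinity>"
proof -
  let ?A = "\<integral>\<^sup>+\<omega>. ennreal (exp (\<theta> * c * X \<omega>)) \<partial>M" and ?B = "\<integral>\<^sup>+\<omega>. ennreal (exp (\<theta> * W \<omega>)) \<partial>M"
  have "?A * ?B = (\<integral>\<^sup>+\<omega>. ennreal (exp (\<theta> * c * X \<omega>)) * ennreal (exp (\<theta> * W \<omega>)) \<partial>M)"
    by (rule nn_integral_indep_mult[OF indep, symmetric]) measurable
  also have "\<dots> = (\<integral>\<^sup>+\<omega>. ennreal (exp (\<theta> * Y \<omega>)) \<partial>M)"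
  proof (rule nn_integral_cong_AE)
    show "AE \<omega> in M. ennreal (exp (\<theta> * c * X \<omega>)) * ennreal (exp (\<theta> * W \<omega>)) = ennreal (exp (\<theta> * Y \<omega>))"
      using Y_eq by eventually_elim (simp add: algebra_simps exp_add flip: ennreal_mult)
  qed
  also have "\<dots> < \<infinity>"
    by (rule nn_integral_exp_finite[OF _ tail_Y G assms]) simp
  finally have fin: "?A * ?B < \<infinity>" .
  \<comment> \<open>Needed because the product of 0 and infinity is 0 in
    \<open>ennreal\<close>.\<close>
  have "?A \<noteq> 0"
    by (subst nn_integral_0_iff_AE) (auto simp: AE_False[THEN iffD1])
  then show ?thesis
    using fin by (auto simp: ennreal_mult_less_top)
qed

text \<open>On the event, \<open>p * (X - x) + q * (Y - y)\<close> is nonnegative. Inserting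
  \<open>Y = c * X + W\<close> splits its exponential into independent factors of orders
  \<open>p + q * c\<close> in \<open>X\<close> and \<open>q\<close> in \<open>W\<close>, both below
  \<open>\<beta>\<close>.\<close>

lemma chernoff:
  assumes pq: "0 \<le> p" "0 \<le> q" "q < \<beta>" "p + q * c < \<beta>"
  shows "\<exists>K>0. \<forall>x y. prob {\<omega>\<in>space M. X \<omega> > x \<and> Y \<omega> > y} \<le> K * exp (- p * x - q * y)"
proof -
  let ?A = "\<integral>\<^sup>+\<omega>. ennreal (exp ((p + q * c) * X \<omega>)) \<partial>M" and ?B = "\<integral>\<^sup>+\<omega>. ennreal (exp (q * W \<omega>)) \<partial>M"
  have "?A * ?B < \<infinity>"
    using nn_integral_exp_X[of "p + q * c"] nn_integral_exp_W[of q] pq c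
    by (simp add: ennreal_mult_less_top)
  then obtain K where K: "?A * ?B = ennreal K" "K \<ge> 0"
    by (cases "?A * ?B") auto
  have "prob {\<omega>\<in>space M. X \<omega> > x \<and> Y \<omega> > y} \<le> (K + 1) * exp (- p * x - q * y)" for x y
  proof -
    let ?e = "exp (- p * x - q * y)"
    have "emeasure M {\<omega>\<in>space M. X \<omega> > x \<and> Y \<omega> > y}
        = (\<integral>\<^sup>+\<omega>. indicator {\<omega>\<in>space M. X \<omega> > x \<and> Y \<omega> > y} \<omega> \<partial>M)"
      by (intro nn_integral_indicator[symmetric]) measurable
    also have "\<dots> \<le> (\<integral>\<^sup>+\<omega>. ennreal ?e * (ennreal (exp ((p + q * c) * X \<omega>)) * ennreal (exp (q * W \<omega>))) \<partial>M)"
    proof (rule nn_integral_mono_AE)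
      show "AE \<omega> in M. indicator {\<omega>\<in>space M. X \<omega> > x \<and> Y \<omega> > y} \<omega>
          \<le> ennreal ?e * (ennreal (exp ((p + q * c) * X \<omega>)) * ennreal (exp (q * W \<omega>)))"
        using Y_eq
      proof eventually_elim
        case (elim \<omega>)
        show ?case
        proof (cases "X \<omega> > x \<and> Y \<omega> > y")
          case True
          then have "0 \<le> p * (X \<omega> - x) + q * (Y \<omega> - y)" using pq by simp
          then have "1 \<le> exp (p * (X \<omega> - x) + q * (Y \<omega> - y))" by simp
          also have "\<dots> = ?e * (exp ((p + q * c) * X \<omega>) * exp (q * W \<omega>))"
            unfolding elim by (simp add: algebra_simps flip: exp_add)
          finally have "ennreal 1 \<le> ennreal (?e * (exp ((p + q * c) * X \<omega>) * exp (q * W \<omega>)))"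
            by (rule ennreal_leI)
          then show ?thesis by (auto simp: ennreal_mult split: split_indicator)
        qed auto
      qed
    qed
    also have "\<dots> = ennreal ?e * (?A * ?B)"
      by (subst nn_integral_cmult) (auto simp: nn_integral_indep_mult[OF indep, of "\<lambda>v. ennreal (exp ((p + q * c) * v))" "\<lambda>v. ennreal (exp (q * v))"])
    also have "\<dots> = ennreal (K * ?e)"
      using K by (simp add: ennreal_mult mult.commute)
    finally have "prob {\<omega>\<in>space M. X \<omega> > x \<and> Y \<omega> > y} \<le> K * ?e"
      using K by (simp add: emeasure_eq_measure)
    then show ?thesis by (rule order_trans) simp
  qed
  \<comment> \<open>\<open>K\<close> may only be known to be nonnegative; adding 1 makes the
    constant positive.\<close>
  then show ?thesis using K by (intro exI[of _ "K + 1"]) auto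
qed

lemma G_upper:
  assumes "0 < \<theta>" "\<theta> < \<beta>"
  shows "\<exists>C>0. \<forall>x. G x \<le> C * exp (- \<theta> * x)"
proof -
  obtain A where A: "(\<integral>\<^sup>+\<omega>. ennreal (exp (\<theta> * X \<omega>)) \<partial>M) = ennreal A" "A \<ge> 0"
    using nn_integral_exp_X[of \<theta>] assms by (cases "\<integral>\<^sup>+\<omega>. ennreal (exp (\<theta> * X \<omega>)) \<partial>M") auto
  have "G x \<le> (A + 1) * exp (- \<theta> * x)" for x
  proof -
    have "ennreal (G x) = (\<integral>\<^sup>+\<omega>. indicator {\<omega>\<in>space M. X \<omega> > x} \<omega> \<partial>M)"
      unfolding tail_X[symmetric] emeasure_eq_measure[symmetric]
      by (intro nn_integral_indicator[symmetric]) measurable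
    also have "\<dots> \<le> (\<integral>\<^sup>+\<omega>. ennreal (exp (- \<theta> * x)) * ennreal (exp (\<theta> * X \<omega>)) \<partial>M)"
    proof (rule nn_integral_mono)
      fix \<omega>
      have "ennreal 1 \<le> ennreal (exp (- \<theta> * x) * exp (\<theta> * X \<omega>))" if "X \<omega> > x"
        using that assms by (intro ennreal_leI) (simp flip: exp_add)
      then show "indicator {\<omega>\<in>space M. X \<omega> > x} \<omega> \<le> ennreal (exp (- \<theta> * x)) * ennreal (exp (\<theta> * X \<omega>))"
        by (auto simp: ennreal_mult split: split_indicator)
    qed
    also have "\<dots> = ennreal (exp (- \<theta> * x) * A)"
      using A(2) by (simp add: nn_integral_cmult A(1) ennreal_mult)
    finally have "G x \<le> A * exp (- \<theta> * x)" using A by (simp add: mult.commute)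
    then show ?thesis by (rule order_trans) simp
  qed
  then show ?thesis using A by (intro exI[of _ "A + 1"]) auto
qed

text \<open>
  If \<open>Y > y\<close> but \<open>W \<le> y / m\<close>, then \<open>X > \<epsilon>y / c\<close>; by Chernoff's bound that event, together with \<open>Y > y\<close>,
  decays at rate at least \<open>\<beta> + \<eta>\<close> and is negligible against \<open>G y\<close>.
\<close>

lemma G_le_tail_W:
  assumes "m > 1"
  shows "\<forall>\<^sub>F y in at_top. G y \<le> 2 * prob {\<omega>\<in>space M. W \<omega> > y / m}"
proof -
  \<comment> \<open>If \<open>Y > y\<close> and \<open>W \<le> y / m\<close>, then
    \<open>c * X\<close> exceeds the remaining share \<open>\<epsilon> * y\<close>.\<close>
  define \<epsilon> where "\<epsilon> = 1 - 1 / m"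
  have \<epsilon>: "\<epsilon> > 0" using assms by (simp add: \<epsilon>_def)
  \<comment> \<open>With this \<open>p\<close>, the order \<open>p + q * c\<close> reaches
    \<open>\<beta>\<close> exactly at \<open>q = \<beta>\<close>; lowering \<open>q\<close> by
    \<open>\<eta>\<close> leaves the room \<open>\<eta> * c\<close>.\<close>
  define p where "p = (1 - c) * \<beta>"
  have p: "p > 0" using c \<beta> by (simp add: p_def)
  \<comment> \<open>The gain \<open>p * \<epsilon> / c\<close> from the event on \<open>X\<close>
    must repay the \<open>\<eta>\<close> given up in \<open>q\<close> and leave another
    \<open>\<eta>\<close>; the bound \<open>\<beta> / 2\<close> keeps \<open>q\<close>
    nonnegative.\<close>
  define \<eta> where "\<eta> = min (\<beta> / 2) (p * \<epsilon> / (2 * c))"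
  have \<eta>: "\<eta> > 0" "\<eta> \<le> \<beta> / 2" "2 * \<eta> \<le> p * \<epsilon> / c"
    using p \<epsilon> c \<beta> unfolding \<eta>_def by (auto simp: min_def field_simps)
  have "p + (\<beta> - \<eta>) * c = \<beta> - \<eta> * c" by (simp add: p_def algebra_simps)
  then have "p + (\<beta> - \<eta>) * c < \<beta>" using \<eta> c by simp
  then obtain K where K: "K > 0" and chern: "\<And>x y. prob {\<omega>\<in>space M. X \<omega> > x \<and> Y \<omega> > y} \<le> K * exp (- p * x - (\<beta> - \<eta>) * y)"
    using chernoff[of p "\<beta> - \<eta>"] p \<eta> \<beta> by auto
  obtain C where C: "C > 0" and C_le: "\<forall>\<^sub>F y in at_top. C * exp (- (\<beta> + \<eta> / 2) * y) \<le> G y"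
    using exponential_tail_lower[OF G G_antimono, of "\<beta> + \<eta> / 2"] \<eta> \<beta> by auto
  have "((\<lambda>y. exp (- (\<eta> / 2) * y)) \<longlongrightarrow> 0) at_top"
    using \<eta> by (intro filterlim_compose[OF exp_at_bot] filterlim_tendsto_neg_mult_at_bot[OF tendsto_const] filterlim_ident) auto
  \<comment> \<open>Below this threshold the event on \<open>X\<close> contributes at most half of
    the lower bound for \<open>G y\<close>, which explains the factor 2 in the claim.\<close>
  then have "\<forall>\<^sub>F y in at_top. exp (- (\<eta> / 2) * y) < C / (2 * K)"
    using C K by (intro order_tendstoD) auto
  with C_le eventually_ge_at_top[of 0] show ?thesis
  proof eventually_elim
    case (elim y)
    have "G y \<le> prob ({\<omega>\<in>space M. W \<omega> > y / m} \<union> {\<omega>\<in>space M. X \<omega> > \<epsilon> * y / c \<and> Y \<omega> > y})"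
      unfolding tail_Y[symmetric]
    proof (rule finite_measure_mono_AE)
      show "AE \<omega> in M. \<omega> \<in> {\<omega>\<in>space M. Y \<omega> > y} \<longrightarrow>
          \<omega> \<in> {\<omega>\<in>space M. W \<omega> > y / m} \<union> {\<omega>\<in>space M. X \<omega> > \<epsilon> * y / c \<and> Y \<omega> > y}"
        using Y_eq
      proof eventually_elim
        case (elim \<omega>)
        have "X \<omega> > \<epsilon> * y / c" if "W \<omega> \<le> y / m" "Y \<omega> > y"
        proof -
          have "c * X \<omega> > \<epsilon> * y" using that elim by (simp add: \<epsilon>_def algebra_simps)
          then show ?thesis using c by (simp add: pos_divide_less_eq mult.commute)
        qed
        then show ?case using linorder_not_less[of "y / m" "W \<omega>"] by auto
      qed
    qed measurable
    also have "\<dots> \<le> prob {\<omega>\<in>space M. W \<omega> > y / m} + prob {\<omega>\<in>space M. X \<omega> > \<epsilon> * y / c \<and> Y \<omega> > y}"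
      by (intro measure_Un_le) measurable
    also have "prob {\<omega>\<in>space M. X \<omega> > \<epsilon> * y / c \<and> Y \<omega> > y} \<le> G y / 2"
    proof -
      have "2 * \<eta> * y \<le> p * \<epsilon> / c * y" using \<eta> elim by (intro mult_right_mono) auto
      then have "- p * (\<epsilon> * y / c) - (\<beta> - \<eta>) * y \<le> - (\<beta> + \<eta>) * y" by (simp add: algebra_simps)
      then have "exp (- p * (\<epsilon> * y / c) - (\<beta> - \<eta>) * y) \<le> exp (- (\<beta> + \<eta>) * y)" by (simp only: exp_le_cancel_iff)
      then have "prob {\<omega>\<in>space M. X \<omega> > \<epsilon> * y / c \<and> Y \<omega> > y} \<le> K * exp (- (\<beta> + \<eta>) * y)"
        using chern[of "\<epsilon> * y / c" y] K by (meson mult_left_mono order_trans less_imp_le)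
      also have "\<dots> = K * exp (- (\<eta> / 2) * y) * exp (- (\<beta> + \<eta> / 2) * y)"
        by (simp add: algebra_simps flip: exp_add)
      also have "\<dots> \<le> C / 2 * exp (- (\<beta> + \<eta> / 2) * y)"
        using elim K by (intro mult_right_mono) (auto simp: field_simps)
      also have "\<dots> \<le> G y / 2" using elim by simp
      finally show ?thesis .
    qed
    finally show ?case by simp
  qed
qed

text \<open>Two losses occur: \<open>G\<close> is bounded below at rate \<open>m * \<beta>\<close>
  instead of \<open>\<beta>\<close>, and passing to \<open>W\<close> rescales the argument by
  \<open>m\<close>. With \<open>m = sqrt (\<theta> / \<beta>)\<close> they amount to exactly
  \<open>\<theta>\<close>.\<close>

lemma tail_W_lower:
  assumes "\<theta> > \<beta>"
  shows "\<exists>C>0. \<forall>\<^sub>F w in at_top. C * exp (- \<theta> * w) \<le> prob {\<omega>\<in>space M. W \<omega> > w}"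
proof -
  define m where "m = sqrt (\<theta> / \<beta>)"
  have m: "m > 1" using assms \<beta> by (simp add: m_def)
  have \<theta>: "\<theta> = m * \<beta> * m" using assms \<beta> by (simp add: m_def mult.commute mult.left_commute)
  obtain C where C: "C > 0" "\<forall>\<^sub>F y in at_top. C * exp (- (m * \<beta>) * y) \<le> G y"
    using exponential_tail_lower[OF G G_antimono, of "m * \<beta>"] m \<beta> by auto
  have lim: "filterlim (\<lambda>w. m * w) at_top at_top"
    using m by (intro filterlim_tendsto_pos_mult_at_top[OF tendsto_const] filterlim_ident) auto
  have "\<forall>\<^sub>F y in at_top. C / 2 * exp (- (m * \<beta>) * y) \<le> prob {\<omega>\<in>space M. W \<omega> > y / m}"
    using C(2) G_le_tail_W[OF m] by eventually_elim simp
  from eventually_compose_filterlim[OF this lim]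
  have "\<forall>\<^sub>F w in at_top. C / 2 * exp (- \<theta> * w) \<le> prob {\<omega>\<in>space M. W \<omega> > w}"
    using m by (simp add: \<theta> mult.assoc)
  then show ?thesis using C by (intro exI[of _ "C / 2"]) auto
qed

definition joint_tail :: "real \<Rightarrow> real" where
  "joint_tail x = prob {\<omega>\<in>space M. X \<omega> > x \<and> Y \<omega> > x}"

text \<open>The Chernoff weights \<open>p = (1 - c) * q\<close> and \<open>q\<close> balance the two
  moments: \<open>p + q * c = q\<close>, so both have order \<open>q < \<beta>\<close>, while the
  total rate is \<open>p + q = (2 - c) * q = \<theta>\<close>.\<close>

lemma joint_tail_upper:
  assumes "0 < \<theta>" "\<theta> < (2 - c) * \<beta>"
  shows "\<exists>C>0. \<forall>x. joint_tail x \<le> C * exp (- \<theta> * x)"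
proof -
  define q where "q = \<theta> / (2 - c)"
  have "\<theta> = (2 - c) * q" using c by (simp add: q_def)
  then have q: "0 < q" "q < \<beta>" "\<theta> = (1 - c) * q + q"
    using assms c by (simp_all add: zero_less_mult_iff algebra_simps) (simp_all add: q_def field_simps)
  have "(1 - c) * q + q * c = q" by (simp add: algebra_simps)
  then obtain K where "K > 0" "\<And>x. joint_tail x \<le> K * exp (- ((1 - c) * q) * x - q * x)"
    using chernoff[of "(1 - c) * q" q] q c unfolding joint_tail_def by auto
  moreover have "- ((1 - c) * q) * x - q * x = - \<theta> * x" for x
    unfolding q(3) by (simp add: algebra_simps)
  ultimately show ?thesis by metis
qed

text \<open>Once \<open>X > x\<close>, the term \<open>c * X\<close> exceeds \<open>c * x\<close>
  and \<open>W\<close> has to cover only \<open>(1 - c) * x\<close>; independence factors the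
  probability.\<close>

lemma joint_tail_ge: "G x * prob {\<omega>\<in>space M. W \<omega> > (1 - c) * x} \<le> joint_tail x"
proof -
  have "G x * prob {\<omega>\<in>space M. W \<omega> > (1 - c) * x} = prob {\<omega>\<in>space M. X \<omega> > x \<and> W \<omega> > (1 - c) * x}"
    using indep_varD[OF indep, of "{x<..}" "{(1 - c) * x<..}"]
    by (simp add: tail_X[symmetric] vimage_def Int_def conj_commute)
  also have "\<dots> \<le> joint_tail x"
    unfolding joint_tail_def
  proof (rule finite_measure_mono_AE)
    show "AE \<omega> in M. \<omega> \<in> {\<omega>\<in>space M. X \<omega> > x \<and> W \<omega> > (1 - c) * x} \<longrightarrow> \<omega> \<in> {\<omega>\<in>space M. X \<omega> > x \<and> Y \<omega> > x}"
      using Y_eq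
    proof eventually_elim
      case (elim \<omega>)
      have "Y \<omega> > x" if "X \<omega> > x" "W \<omega> > (1 - c) * x"
        using mult_strict_left_mono[OF that(1) c(1)] that(2) elim by (simp add: algebra_simps)
      then show ?case by auto
    qed
  qed measurable
  finally show ?thesis .
qed

text \<open>A single rate \<open>t > \<beta>\<close> serves both factors: \<open>X\<close>
  contributes \<open>t\<close> and \<open>W\<close>, at \<open>(1 - c) * x\<close>, contributes
  \<open>t * (1 - c)\<close>.\<close>

lemma joint_tail_lower:
  assumes "(2 - c) * \<beta> < \<theta>"
  shows "\<exists>C>0. \<forall>\<^sub>F x in at_top. C * exp (- \<theta> * x) \<le> joint_tail x"
proof -
  define t where "t = \<theta> / (2 - c)"
  have "\<theta> = (2 - c) * t" using c by (simp add: t_def)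
  then have t: "t > \<beta>" "\<theta> = t + t * (1 - c)"
    using assms c by simp_all (simp add: algebra_simps)
  obtain A where A: "A > 0" "\<forall>\<^sub>F x in at_top. A * exp (- t * x) \<le> G x"
    using exponential_tail_lower[OF G G_antimono t(1)] t \<beta> by auto
  obtain B where B: "B > 0" "\<forall>\<^sub>F x in at_top. B * exp (- t * x) \<le> prob {\<omega>\<in>space M. W \<omega> > x}"
    using tail_W_lower[OF t(1)] by auto
  have "filterlim (\<lambda>x. (1 - c) * x) at_top at_top"
    using c by (intro filterlim_tendsto_pos_mult_at_top[OF tendsto_const] filterlim_ident) auto
  from A(2) eventually_compose_filterlim[OF B(2) this]
  have "\<forall>\<^sub>F x in at_top. A * B * exp (- \<theta> * x) \<le> joint_tail x"
  proof eventually_elim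
    case (elim x)
    have "A * B * exp (- \<theta> * x) = (A * exp (- t * x)) * (B * exp (- t * ((1 - c) * x)))"
      unfolding t(2) by (simp add: algebra_simps flip: exp_add)
    also have "\<dots> \<le> G x * prob {\<omega>\<in>space M. W \<omega> > (1 - c) * x}"
      using elim A B G_pos[of x] by (intro mult_mono) auto
    also have "\<dots> \<le> joint_tail x" by (rule joint_tail_ge)
    finally show ?case .
  qed
  then show ?thesis using A B by (intro exI[of _ "A * B"]) auto
qed

lemma joint_tail_ratio_tendsto: "((\<lambda>x. joint_tail x / G x) \<longlongrightarrow> 0) at_top"
proof -
  \<comment> \<open>The rates of the joint tail and of \<open>G\<close> differ by
    \<open>3 * \<delta>\<close>. Each estimate gives up one \<open>\<delta>\<close>, and one remains
    for the decay of the quotient.\<close>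
  define \<delta> where "\<delta> = (1 - c) * \<beta> / 3"
  have \<delta>: "\<delta> > 0" "(2 - c) * \<beta> = \<beta> + 3 * \<delta>" using c \<beta> by (auto simp: \<delta>_def field_simps)
  obtain A where A: "A > 0" "\<And>x. joint_tail x \<le> A * exp (- (\<beta> + 2 * \<delta>) * x)"
    using joint_tail_upper[of "\<beta> + 2 * \<delta>"] \<delta> \<beta> by auto
  obtain B where B: "B > 0" "\<forall>\<^sub>F x in at_top. B * exp (- (\<beta> + \<delta>) * x) \<le> G x"
    using exponential_tail_lower[OF G G_antimono, of "\<beta> + \<delta>"] \<delta> \<beta> by auto
  have "((\<lambda>x. exp (- \<delta> * x)) \<longlongrightarrow> 0) at_top"
    using \<delta> by (intro filterlim_compose[OF exp_at_bot] filterlim_tendsto_neg_mult_at_bot[OF tendsto_const] filterlim_ident) auto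
  then have lim: "((\<lambda>x. A / B * exp (- \<delta> * x)) \<longlongrightarrow> 0) at_top"
    by (rule tendsto_mult_right_zero)
  show ?thesis
  proof (rule tendsto_sandwich[OF _ _ tendsto_const lim])
    show "\<forall>\<^sub>F x in at_top. 0 \<le> joint_tail x / G x"
      using G_pos by (simp add: joint_tail_def less_imp_le)
    show "\<forall>\<^sub>F x in at_top. joint_tail x / G x \<le> A / B * exp (- \<delta> * x)"
      using B(2)
    proof eventually_elim
      case (elim x)
      have "joint_tail x / G x \<le> A * exp (- (\<beta> + 2 * \<delta>) * x) / (B * exp (- (\<beta> + \<delta>) * x))"
        using A(1) A(2)[of x] B(1) elim G_pos[of x] by (intro frac_le) auto
      also have "\<dots> = A / B * exp (- \<delta> * x)"
        using B(1) by (simp add: divide_simps) (simp add: algebra_simps mult_exp_exp)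
      finally show ?case .
    qed
  qed
qed

text \<open>Both logarithms are asymptotically linear in \<open>x\<close>, with slopes
  \<open>- \<beta>\<close> and \<open>- ((2 - c) * \<beta>)\<close>; \<open>\<beta>\<close> cancels
  in the quotient.\<close>

lemma ln_ratio_tendsto: "((\<lambda>x. ln (G x) / ln (joint_tail x)) \<longlongrightarrow> 1 / (2 - c)) at_top"
proof -
  have "((\<lambda>x. ln (G x) / x) \<longlongrightarrow> - \<beta>) at_top"
  proof (rule ln_rate_tendsto[OF \<beta>])
    show "\<exists>C>0. \<forall>\<^sub>F x in at_top. G x \<le> C * exp (- \<theta> * x)" if "0 < \<theta>" "\<theta> < \<beta>" for \<theta>
      using G_upper[OF that] by (blast intro: always_eventually)
    show "\<exists>C>0. \<forall>\<^sub>F x in at_top. C * exp (- \<theta> * x) \<le> G x" if "\<beta> < \<theta>" for \<theta>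
      using that \<beta> by (intro exponential_tail_lower[OF G G_antimono]) auto
  qed
  moreover have "((\<lambda>x. ln (joint_tail x) / x) \<longlongrightarrow> - ((2 - c) * \<beta>)) at_top"
  proof (rule ln_rate_tendsto)
    show "\<exists>C>0. \<forall>\<^sub>F x in at_top. joint_tail x \<le> C * exp (- \<theta> * x)" if "0 < \<theta>" "\<theta> < (2 - c) * \<beta>" for \<theta>
      using joint_tail_upper[OF that] by (blast intro: always_eventually)
  qed (use \<beta> c joint_tail_lower in auto)
  ultimately have "((\<lambda>x. (ln (G x) / x) / (ln (joint_tail x) / x)) \<longlongrightarrow> - \<beta> / - ((2 - c) * \<beta>)) at_top"
    using c \<beta> by (intro tendsto_divide) auto
  then have "((\<lambda>x. (ln (G x) / x) / (ln (joint_tail x) / x)) \<longlongrightarrow> 1 / (2 - c)) at_top"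
    using \<beta> by simp
  moreover have "\<forall>\<^sub>F x in at_top. (ln (G x) / x) / (ln (joint_tail x) / x) = ln (G x) / ln (joint_tail x)"
    using eventually_gt_at_top[of 0] by eventually_elim simp
  ultimately show ?thesis by (rule Lim_transform_eventually)
qed

end

section \<open>Innovations of the stationary solution\<close>

lemma cadlag_scale:
  assumes "cadlag f" "a > 0"
  shows "cadlag (\<lambda>t. f (a * t))"
  unfolding cadlag_def continuous_within
proof (intro allI conjI)
  fix t
  have "filterlim ((*) a) (at_right (a * t)) (at_right t)" "filterlim ((*) a) (at_left (a * t)) (at_left t)"
    unfolding filterlim_at using \<open>a > 0\<close>
    by (auto simp: eventually_at_filter intro!: tendsto_intros)
  moreover obtain l where "(f \<longlongrightarrow> f (a * t)) (at_right (a * t))" "(f \<longlongrightarrow> l) (at_left (a * t))"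
    using assms unfolding cadlag_def continuous_within by blast
  ultimately show "((\<lambda>t. f (a * t)) \<longlongrightarrow> f (a * t)) (at_right t)" "\<exists>l. ((\<lambda>t. f (a * t)) \<longlongrightarrow> l) (at_left t)"
    by (blast intro: filterlim_compose)+
qed

lemma strict_mono_on_atMostI:
  fixes t :: "nat \<Rightarrow> real"
  assumes "\<And>i. i < n \<Longrightarrow> t i < t (Suc i)"
  shows "strict_mono_on {..n} t"
proof (rule strict_mono_onI)
  fix i j assume "i < j" "j \<in> {..n}"
  then show "t i < t j"
  proof (induction j)
    case (Suc j)
    then show ?case using assms[of j] by (cases "i = j") auto
  qed simp
qed

locale OU_process = prob_space +
  fixes a :: real and z u :: "real \<Rightarrow> 'a \<Rightarrow> real"
  assumes a: "a > 0"
    and levy: "levy_process M z"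
    and OU: "OU_equation M a z u"
    and stationary: "strictly_stationary M u"
begin

lemma u_measurable [measurable]: "random_variable borel (u t)"
  using OU unfolding OU_equation_def by blast

lemma langevin_paths: "AE \<omega> in M. langevin_path a (\<lambda>t. u t \<omega>) (\<lambda>t. z (a * t) \<omega>)"
proof -
  have "AE \<omega> in M. cadlag (\<lambda>t. z t \<omega>)"
    using levy unfolding levy_process_def by blast
  moreover have "AE \<omega> in M. \<forall>s t. s \<le> t \<longrightarrow> (\<lambda>r. u r \<omega>) integrable_on {s..t} \<and>
      u t \<omega> - u s \<omega> = - a * integral {s..t} (\<lambda>r. u r \<omega>) + (z (a * t) \<omega> - z (a * s) \<omega>)"
    using OU unfolding OU_equation_def by blast
  ultimately show ?thesis
  proof eventually_elim
    case (elim \<omega>)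
    then show ?case
      using cadlag_scale[OF elim(1) a] by unfold_locales blast+
  qed
qed

text \<open>The left-point Riemann sum of the integral of \<open>exp (- a * (s - v))\<close> against
  \<open>z (a * v)\<close> over \<open>v\<close> from \<open>r\<close> to \<open>s\<close>.\<close>

definition noise_sum :: "real \<Rightarrow> real \<Rightarrow> nat \<Rightarrow> 'a \<Rightarrow> real" where
  "noise_sum r s n \<omega> = (\<Sum>i<Suc n. exp (- a * (s - mesh r s n i)) *
     (z (a * mesh r s n (Suc i)) \<omega> - z (a * mesh r s n i) \<omega>))"

lemma noise_sum_tendsto:
  assumes "r < s"
  shows "AE \<omega> in M. (\<lambda>n. noise_sum r s n \<omega>) \<longlonglongrightarrow> u s \<omega> - exp (- a * (s - r)) * u r \<omega>"
  using langevin_paths unfolding noise_sum_def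
  by eventually_elim (rule langevin_path.sum_mesh_tendsto[OF _ assms])

text \<open>The meshes of \<open>{r..s}\<close> and \<open>{s..t}\<close> are joined into one
  increasing sequence, whose increments of \<open>z\<close> are jointly independent; the two sums
  use disjoint blocks of them.\<close>

lemma indep_noise_sum:
  assumes "r < s" "s < t"
  shows "indep_var borel (noise_sum r s n) borel (noise_sum s t n)"
proof -
  let ?N = "Suc n"
  define \<tau> where "\<tau> i = a * (if i \<le> ?N then mesh r s n i else mesh s t n (i - ?N))" for i
  define D where "D i \<omega> = z (\<tau> (Suc i)) \<omega> - z (\<tau> i) \<omega>" for i \<omega>
  have \<tau>1: "\<tau> i = a * mesh r s n i" if "i \<le> ?N" for i using that by (simp add: \<tau>_def)
  \<comment> \<open>At \<open>i = 0\<close> the first branch of \<open>\<tau>\<close> applies, but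
    both meshes have the value \<open>s\<close> there.\<close>
  have \<tau>2: "\<tau> (?N + i) = a * mesh s t n i" for i by (cases i) (simp_all add: \<tau>_def)
  have "strict_mono_on {..?N + ?N} \<tau>"
  proof (rule strict_mono_on_atMostI)
    fix i assume "i < ?N + ?N"
    show "\<tau> i < \<tau> (Suc i)"
    proof (cases "i < ?N")
      case True
      then show ?thesis using a assms by (simp add: \<tau>1 mesh_less)
    next
      case False
      then obtain j where "i = ?N + j" by (metis le_add_diff_inverse not_less)
      then show ?thesis using a assms \<tau>2[of j] \<tau>2[of "Suc j"] by (simp add: mesh_less)
    qed
  qed
  then have "indep_vars (\<lambda>_. borel) D {..<?N + ?N}"
    using levy unfolding levy_process_def D_def by blast
  then have "indep_var (Pi\<^sub>M {..<?N} (\<lambda>_. borel)) (\<lambda>\<omega>. \<lambda>i\<in>{..<?N}. D i \<omega>)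
      (Pi\<^sub>M {?N..<?N + ?N} (\<lambda>_. borel)) (\<lambda>\<omega>. \<lambda>i\<in>{?N..<?N + ?N}. D i \<omega>)"
    by (rule indep_var_restrict) auto
  then have "indep_var
      borel ((\<lambda>f. \<Sum>i<?N. exp (- a * (s - mesh r s n i)) * f i) \<circ> (\<lambda>\<omega>. \<lambda>i\<in>{..<?N}. D i \<omega>))
      borel ((\<lambda>f. \<Sum>i<?N. exp (- a * (t - mesh s t n i)) * f (?N + i)) \<circ> (\<lambda>\<omega>. \<lambda>i\<in>{?N..<?N + ?N}. D i \<omega>))"
    by (rule indep_var_compose)
      (intro borel_measurable_sum borel_measurable_times borel_measurable_const measurable_component_singleton; auto)+
  moreover have "(\<lambda>f. \<Sum>i<?N. exp (- a * (s - mesh r s n i)) * f i) \<circ> (\<lambda>\<omega>. \<lambda>i\<in>{..<?N}. D i \<omega>) = noise_sum r s n"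
    unfolding comp_def noise_sum_def by (intro ext sum.cong) (auto simp: D_def \<tau>1)
  moreover have "(\<lambda>f. \<Sum>i<?N. exp (- a * (t - mesh s t n i)) * f (?N + i)) \<circ> (\<lambda>\<omega>. \<lambda>i\<in>{?N..<?N + ?N}. D i \<omega>) = noise_sum s t n"
    unfolding comp_def noise_sum_def
  proof (intro ext sum.cong refl)
    fix \<omega> i assume "i \<in> {..<?N}"
    then show "exp (- a * (t - mesh s t n i)) * (\<lambda>i\<in>{?N..<?N + ?N}. D i \<omega>) (?N + i) =
        exp (- a * (t - mesh s t n i)) * (z (a * mesh s t n (Suc i)) \<omega> - z (a * mesh s t n i) \<omega>)"
      using \<tau>2[of i] \<tau>2[of "Suc i"] by (simp add: D_def)
  qed
  ultimately show ?thesis by simp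
qed

lemma distr_u: "distr M borel (u t) = distr M borel (u 0)"
proof -
  have eq: "distr M (\<Pi>\<^sub>M t\<in>{0}. borel) (\<lambda>\<omega>. \<lambda>s\<in>{0}. u (s + t) \<omega>) = distr M (\<Pi>\<^sub>M t\<in>{0::real}. borel) (\<lambda>\<omega>. \<lambda>s\<in>{0}. u s \<omega>)"
    using stationary unfolding strictly_stationary_def by blast
  have "distr M borel (u (0 + h)) = distr (distr M (\<Pi>\<^sub>M t\<in>{0::real}. borel) (\<lambda>\<omega>. \<lambda>s\<in>{0}. u (s + h) \<omega>)) borel (\<lambda>f. f 0)" for h
    by (subst distr_distr) (auto simp: comp_def)
  from this[of t] this[of 0] eq show ?thesis by simp
qed

text \<open>The discounted past \<open>D n\<close> need not vanish pathwise. By stationarity it has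
  the law of \<open>d n * u 0\<close>, so it tends to 0 in probability, and a subsequence tends to 0
  almost surely.\<close>

lemma indep_innovation:
  assumes "s < t"
  shows "indep_var borel (u s) borel (\<lambda>\<omega>. u t \<omega> - exp (- a * (t - s)) * u s \<omega>)"
proof -
  define d where "d n = exp (- a * real (Suc n))" for n
  define D where "D n \<omega> = d n * u (s - real (Suc n)) \<omega>" for n \<omega>
  have indep: "indep_var borel (\<lambda>\<omega>. u s \<omega> - D n \<omega>) borel (\<lambda>\<omega>. u t \<omega> - exp (- a * (t - s)) * u s \<omega>)" for n
  proof (rule indep_var_AE_limit)
    show "indep_var borel (noise_sum (s - real (Suc n)) s k) borel (noise_sum s t k)" for k
      using assms by (intro indep_noise_sum) auto
    show "AE \<omega> in M. (\<lambda>k. noise_sum (s - real (Suc n)) s k \<omega>) \<longlonglongrightarrow> u s \<omega> - D n \<omega>"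
      using noise_sum_tendsto[of "s - real (Suc n)" s] by (simp add: D_def d_def del: of_nat_Suc)
    show "AE \<omega> in M. (\<lambda>k. noise_sum s t k \<omega>) \<longlonglongrightarrow> u t \<omega> - exp (- a * (t - s)) * u s \<omega>"
      by (rule noise_sum_tendsto[OF assms])
  qed (auto simp: D_def)
  have [measurable]: "random_variable borel (D n)" for n unfolding D_def by measurable
  have d0: "d \<longlonglongrightarrow> 0"
  proof -
    have "filterlim (\<lambda>n. - a * real (Suc n)) at_bot sequentially"
      using a by (intro filterlim_tendsto_neg_mult_at_bot[OF tendsto_const]
          filterlim_compose[OF filterlim_real_sequentially] filterlim_Suc) auto
    then show ?thesis unfolding d_def by (rule filterlim_compose[OF exp_at_bot])
  qed
  \<comment> \<open>Truncation at 1 makes convergence in mean available without any moment of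
    \<open>u\<close>.\<close>
  have "(\<integral>\<omega>. norm (min 1 \<bar>D n \<omega>\<bar>) \<partial>M) = (\<integral>\<omega>. min 1 \<bar>d n * u 0 \<omega>\<bar> \<partial>M)" for n
  proof -
    have "(\<integral>\<omega>. norm (min 1 \<bar>D n \<omega>\<bar>) \<partial>M) = (\<integral>x. min 1 \<bar>d n * x\<bar> \<partial>distr M borel (u (s - real (Suc n))))"
      by (subst integral_distr) (auto simp: D_def)
    also have "\<dots> = (\<integral>\<omega>. min 1 \<bar>d n * u 0 \<omega>\<bar> \<partial>M)"
      unfolding distr_u[of "s - real (Suc n)"] by (subst integral_distr) auto
    finally show ?thesis .
  qed
  moreover have "(\<lambda>n. \<integral>\<omega>. min 1 \<bar>d n * u 0 \<omega>\<bar> \<partial>M) \<longlonglongrightarrow> (\<integral>\<omega>. 0 \<partial>M)"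
  proof (rule integral_dominated_convergence[where w="\<lambda>_. 1"])
    show "AE \<omega> in M. (\<lambda>n. min 1 \<bar>d n * u 0 \<omega>\<bar>) \<longlonglongrightarrow> 0"
    proof (rule AE_I2)
      fix \<omega>
      have "(\<lambda>n. min 1 \<bar>d n * u 0 \<omega>\<bar>) \<longlonglongrightarrow> min 1 \<bar>0 * u 0 \<omega>\<bar>"
        by (intro tendsto_intros d0)
      then show "(\<lambda>n. min 1 \<bar>d n * u 0 \<omega>\<bar>) \<longlonglongrightarrow> 0" by simp
    qed
  qed auto
  ultimately have "(\<lambda>n. \<integral>\<omega>. norm (min 1 \<bar>D n \<omega>\<bar>) \<partial>M) \<longlonglongrightarrow> 0" by simp
  moreover have "integrable M (\<lambda>\<omega>. min 1 \<bar>D n \<omega>\<bar>)" for n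
    by (rule integrable_const_bound[where B=1]) auto
  ultimately obtain \<rho> :: "nat \<Rightarrow> nat" where \<rho>: "AE \<omega> in M. (\<lambda>n. min 1 \<bar>D (\<rho> n) \<omega>\<bar>) \<longlonglongrightarrow> 0"
    using tendsto_L1_AE_subseq[of M "\<lambda>n \<omega>. min 1 \<bar>D n \<omega>\<bar>"] by blast
  show ?thesis
  proof (rule indep_var_AE_limit[OF indep])
    show "AE \<omega> in M. (\<lambda>n. u s \<omega> - D (\<rho> n) \<omega>) \<longlonglongrightarrow> u s \<omega>"
      using \<rho>
    proof eventually_elim
      case (elim \<omega>)
      \<comment> \<open>Once the truncated value is below 1, the truncation has no effect.\<close>
      have "\<forall>\<^sub>F n in sequentially. min 1 \<bar>D (\<rho> n) \<omega>\<bar> < 1"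
        using elim by (rule order_tendstoD) simp
      then have "\<forall>\<^sub>F n in sequentially. min 1 \<bar>D (\<rho> n) \<omega>\<bar> = \<bar>D (\<rho> n) \<omega>\<bar>"
        by eventually_elim linarith
      with elim have "(\<lambda>n. \<bar>D (\<rho> n) \<omega>\<bar>) \<longlonglongrightarrow> 0" by (simp add: tendsto_cong)
      then have "(\<lambda>n. D (\<rho> n) \<omega>) \<longlonglongrightarrow> 0" by (rule tendsto_rabs_zero_cancel)
      then have "(\<lambda>n. u s \<omega> - D (\<rho> n) \<omega>) \<longlonglongrightarrow> u s \<omega> - 0" by (intro tendsto_intros)
      then show ?case by simp
    qed
  qed auto
qed

end

section \<open>Passage to quantiles\<close>

text \<open>Taking the largest solution of \<open>F x = q\<close> makes \<open>q < F y\<close>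
  equivalent to \<open>Q q < y\<close> even where \<open>F\<close> is flat. As \<open>F\<close>
  never reaches 1, \<open>Q\<close> tends to infinity.\<close>

lemma quantile_exists:
  fixes F :: "real \<Rightarrow> real"
  assumes "mono F" "\<And>x. isCont F x" "(F \<longlongrightarrow> 0) at_bot" "(F \<longlongrightarrow> 1) at_top" "\<And>x. F x < 1"
  obtains Q where "\<And>q. 0 < q \<Longrightarrow> q < 1 \<Longrightarrow> F (Q q) = q"
    and "\<And>q y. 0 < q \<Longrightarrow> q < 1 \<Longrightarrow> q < F y \<longleftrightarrow> Q q < y"
    and "filterlim Q at_top (at_left 1)"
proof -
  define Q where "Q q = Sup {x. F x \<le> q}" for q
  have Q: "F (Q q) = q \<and> (\<forall>y. q < F y \<longleftrightarrow> Q q < y)" if q: "0 < q" "q < 1" for q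
  proof -
    have "\<forall>\<^sub>F x in at_bot. F x < q" "\<forall>\<^sub>F x in at_top. q < F x"
      using q assms(3,4) by (auto dest: order_tendstoD)
    then obtain l r where l: "F l < q" and r: "q < F r"
      by (metis eventually_at_bot_linorder eventually_at_top_linorder order_refl)
    then have "l \<le> r" using \<open>mono F\<close> by (metis linorder_le_cases monoD not_less order_trans less_imp_le)
    then obtain x where x: "F x = q"
      using IVT[of F l q r] l r assms(2) by auto
    let ?S = "{x. F x \<le> q}"
    have bdd: "bdd_above ?S"
      using r \<open>mono F\<close> by (intro bdd_aboveI[of _ r]) (metis linorder_le_cases mem_Collect_eq monoD not_less order_trans)
    have "closed ?S"
      using assms(2) by (intro closed_Collect_le continuous_on_const) (simp add: continuous_at_imp_continuous_on)
    then have mem: "F (Q q) \<le> q"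
      using closed_contains_Sup[of ?S] bdd less_imp_le[OF l] unfolding Q_def by blast
    have up: "y \<le> Q q" if "F y \<le> q" for y
      unfolding Q_def using that bdd by (intro cSup_upper) auto
    have "F x \<le> F (Q q)" using up[of x] x \<open>mono F\<close> by (auto dest: monoD)
    moreover have "q < F y \<longleftrightarrow> Q q < y" for y
      using up[of y] mem monoD[OF \<open>mono F\<close>, of y "Q q"] by (meson not_less order_trans)
    ultimately show ?thesis using mem x by simp
  qed
  moreover have "filterlim Q at_top (at_left 1)"
    unfolding filterlim_at_top_dense
  proof
    fix K
    have "\<forall>\<^sub>F q in at_left 1. q \<in> {max 0 (F K)<..<1}"
      using assms(5)[of K] by (intro eventually_at_left_real) auto
    then show "\<forall>\<^sub>F q in at_left 1. K < Q q"
    proof eventually_elim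
      case (elim q)
      then have "F (Q q) = q" "F K < q" using Q by auto
      then show ?case using monoD[OF \<open>mono F\<close>, of "Q q" K] by (metis linorder_not_less)
    qed
  qed
  ultimately show ?thesis using that by blast
qed

context OU_process begin

context
  fixes \<beta> :: real
  assumes continuous: "\<And>x. measure (distr M borel (u 0)) {x} = 0"
    and \<beta>: "\<beta> > 0"
    and tail: "exponential_tail \<beta> (\<lambda>x. 1 - cdf (distr M borel (u 0)) x)"
begin

text \<open>With \<open>x = Q q\<close>, exceeding \<open>q\<close> on the uniform scale means
  exceeding \<open>x\<close> for the process, so \<open>q\<close> tending to 1 becomes
  \<open>x\<close> tending to infinity.\<close>

lemma joint_exceedance_limits:
  assumes "s < t"
  defines "J \<equiv> \<lambda>q. prob {\<omega>\<in>space M. df M (u s) (u s \<omega>) > q \<and> df M (u t) (u t \<omega>) > q}"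
  shows "((\<lambda>q. J q / (1 - q)) \<longlongrightarrow> 0) (at_left 1)"
    and "((\<lambda>q. ln (1 - q) / ln (J q)) \<longlongrightarrow> 1 / (2 - exp (- a * (t - s)))) (at_left 1)"
    and "\<forall>\<^sub>F q in at_left 1. prob {\<omega>\<in>space M. df M (u r) (u r \<omega>) > q} = 1 - q"
proof -
  define F where "F = cdf (distr M borel (u 0))"
  have df: "df M (u r) = F" for r unfolding df_def F_def distr_u[of r] ..
  interpret D: real_distribution "distr M borel (u 0)" by (intro real_distribution_distr) simp
  have tail_prob: "prob {\<omega>\<in>space M. u r \<omega> > x} = 1 - F x" for r x
  proof -
    have "F x = prob {\<omega>\<in>space M. u r \<omega> \<le> x}"
      unfolding F_def distr_u[of r, symmetric] cdf_def
      by (subst measure_distr) (auto intro!: arg_cong[where f=prob])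
    moreover have "{\<omega>\<in>space M. u r \<omega> > x} = space M - {\<omega>\<in>space M. u r \<omega> \<le> x}" by auto
    ultimately show ?thesis by (simp add: prob_compl)
  qed
  interpret exponential_tail_autoregression M "u s" "u t" "\<lambda>\<omega>. u t \<omega> - exp (- a * (t - s)) * u s \<omega>"
      "exp (- a * (t - s))" \<beta> "\<lambda>x. 1 - F x"
    using indep_innovation[OF assms(1)] assms(1) a \<beta> tail by unfold_locales (auto simp: tail_prob F_def)
  have mono: "mono F" unfolding F_def by (intro monoI D.cdf_nondecreasing)
  have cont: "isCont F x" for x unfolding F_def D.isCont_cdf by (rule continuous)
  have lim: "(F \<longlongrightarrow> 0) at_bot" "(F \<longlongrightarrow> 1) at_top"
    unfolding F_def by (rule D.cdf_lim_at_bot D.cdf_lim_at_top_prob)+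
  have less1: "F x < 1" for x using G_pos[of x] by simp
  obtain Q where Q: "\<And>q. 0 < q \<Longrightarrow> q < 1 \<Longrightarrow> F (Q q) = q"
    "\<And>q y. 0 < q \<Longrightarrow> q < 1 \<Longrightarrow> q < F y \<longleftrightarrow> Q q < y" "filterlim Q at_top (at_left 1)"
    using quantile_exists[OF mono cont lim less1] by blast
  have unit: "\<forall>\<^sub>F q in at_left 1. q \<in> {0<..<1::real}" by (rule eventually_at_left_real) simp
  have J: "J q = joint_tail (Q q)" if "q \<in> {0<..<1}" for q
    using that unfolding J_def joint_tail_def df by (simp add: Q)
  have "\<forall>\<^sub>F q in at_left 1. joint_tail (Q q) / (1 - F (Q q)) = J q / (1 - q)"
    using unit by eventually_elim (simp add: J Q)
  with filterlim_compose[OF joint_tail_ratio_tendsto Q(3)]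
  show "((\<lambda>q. J q / (1 - q)) \<longlongrightarrow> 0) (at_left 1)" by (rule Lim_transform_eventually)
  have "\<forall>\<^sub>F q in at_left 1. ln (1 - F (Q q)) / ln (joint_tail (Q q)) = ln (1 - q) / ln (J q)"
    using unit by eventually_elim (simp add: J Q)
  with filterlim_compose[OF ln_ratio_tendsto Q(3)]
  show "((\<lambda>q. ln (1 - q) / ln (J q)) \<longlongrightarrow> 1 / (2 - exp (- a * (t - s)))) (at_left 1)"
    by (rule Lim_transform_eventually)
  show "\<forall>\<^sub>F q in at_left 1. prob {\<omega>\<in>space M. df M (u r) (u r \<omega>) > q} = 1 - q"
    using unit by eventually_elim (simp add: df Q tail_prob)
qed

text \<open>The joint exceedance is symmetric in the two times, whereas the autoregression runs
  forward, so the times are sorted first. The conditioning event has probability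
  \<open>1 - q\<close> at either time.\<close>

lemma tail_dependence:
  assumes "s \<noteq> t"
  shows "asymptotically_independent M (u s) (u t)"
    and "has_residual_tail_dependence_coefficient M (u s) (u t) (1 / (2 - exp (- a * \<bar>t - s\<bar>)))"
proof -
  define l r where "l = min s t" and "r = max s t"
  have lr: "l < r" "\<bar>t - s\<bar> = r - l" using assms by (auto simp: l_def r_def)
  define J where "J q = prob {\<omega>\<in>space M. df M (u s) (u s \<omega>) > q \<and> df M (u t) (u t \<omega>) > q}" for q
  have J: "J q = prob {\<omega>\<in>space M. df M (u l) (u l \<omega>) > q \<and> df M (u r) (u r \<omega>) > q}" for q
    unfolding J_def l_def r_def min_def max_def by (auto intro!: arg_cong[where f=prob])
  note lim = joint_exceedance_limits[OF lr(1), folded J]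
  show "has_residual_tail_dependence_coefficient M (u s) (u t) (1 / (2 - exp (- a * \<bar>t - s\<bar>)))"
    using lim(2) unfolding has_residual_tail_dependence_coefficient_def lr(2) J_def by simp
  have "\<forall>\<^sub>F q in at_left 1. J q / (1 - q) = \<P>(\<omega> in M. df M (u s) (u s \<omega>) > q \<bar> df M (u t) (u t \<omega>) > q)"
    using lim(3)[of t] by eventually_elim (simp add: cond_prob_def J_def)
  with lim(1) show "asymptotically_independent M (u s) (u t)"
    unfolding asymptotically_independent_def has_tail_dependence_coefficient_def
    by (rule Lim_transform_eventually)
qed

end

end

theorem theorem4p3:
  fixes M :: "'a measure" and N :: "'b measure"
    and a \<beta> s\<^sub>1 s\<^sub>2 :: real
    and z u :: "real \<Rightarrow> 'a \<Rightarrow> real"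
    and V :: "'b \<Rightarrow> real"
  assumes "prob_space M" and "prob_space N"
    and "a > 0"
    and "levy_process M z"
    and "integrable M (\<lambda>\<omega>. ln (1 + \<bar>z 1 \<omega>\<bar>))"
    and "non_gaussian_OU_process M a z u"
    and "V \<in> borel_measurable N"
    and "distr N borel V = distr M borel (u 0)"
    and "\<exists>f. distributed N lborel V f"
    and "\<beta> > 0"
    and "exponential_tail \<beta> (survival_function N V)"
    and "s\<^sub>1 \<noteq> s\<^sub>2"
  shows "asymptotically_independent M (u s\<^sub>1) (u s\<^sub>2) \<and>
    has_residual_tail_dependence_coefficient M (u s\<^sub>1) (u s\<^sub>2)
      (1 / (2 - exp (- a * \<bar>s\<^sub>2 - s\<^sub>1\<bar>)))"
proof -
  interpret prob_space M by fact
  interpret OU_process M a z u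
    using assms(3,4,6) by unfold_locales (auto simp: non_gaussian_OU_process_def)
  obtain f where f: "distributed N lborel V f" using assms(9) by blast
  \<comment> \<open>A Lebesgue density excludes atoms, which makes the distribution function
    continuous.\<close>
  have "measure (distr M borel (u 0)) {x} = 0" for x
  proof -
    have "distr M borel (u 0) = distr N lborel V"
      using assms(8) by (simp cong: distr_cong)
    also have "\<dots> = density lborel f"
      using f by (rule distributed_distr_eq_density)
    also have "emeasure \<dots> {x} = (\<integral>\<^sup>+y. f y * indicator {x} y \<partial>lborel)"
      using distributed_borel_measurable[OF f] by (intro emeasure_density) auto
    also have "\<dots> = 0"
      using distributed_borel_measurable[OF f] AE_lborel_singleton[of x]
      by (subst nn_integral_0_iff_AE) auto
    finally show ?thesis by (simp add: measure_def)
  qed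
  moreover have "exponential_tail \<beta> (\<lambda>x. 1 - cdf (distr M borel (u 0)) x)"
    using assms(11) unfolding survival_function_def[abs_def] df_def assms(8) .
  ultimately show ?thesis
    using tail_dependence[OF _ \<open>\<beta> > 0\<close> _ \<open>s\<^sub>1 \<noteq> s\<^sub>2\<close>] by blast
qed

end
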